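(* There is a hyperplane arrangement whose defining polynomial $f$ has the property that $\mathrm{ann}_{D_n}(f^s)$ is not generated by derivations. Specifically, this is so for the central arrangement in $\mathbb C^4$ (with coordinates $x_0,x_1,x_2,x_3$) defined by $$f=x_1x_2x_3(x_1+x_0)(x_2+x_0)(x_3+x_0)(x_1+x_2+x_0)(x_1+x_3+x_0)(x_2+x_3+x_0).$$
   Context: $D$ denotes the Weyl algebra $\mathbb C[x_0,\dots,x_3]\langle\partial_0,\dots,\partial_3\rangle$ ($=D_n$ with $n=4$). $D[s]$ acts on the free $\mathbb C[x][f^{-1},s]$-module on the symbol $f^s$ by $\delta\bullet(\frac{g}{f^k}f^s)=\delta(\frac{g}{f^k})f^s+\frac{sg}{f^{k+1}}\delta(f)f^s$ for derivations $\delta$; $\mathrm{ann}_{D}(f^s)=\{P\in D:P\bullet f^s=0\}$. "Generated by derivations" means generated as a left ideal by the vector fields $\delta=\sum a_i\partial_i$, $a_i\in\mathbb C[x]$, with $\delta(f)=0$. *)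

theory Defs
  imports
    "HOL-Library.Poly_Mapping"
    "HOL-Library.Numeral_Type"
    "HOL-Computational_Algebra.Polynomial_Factorial"
    "HOL-Analysis.Finite_Cartesian_Product"
begin

section \<open>Polynomials in several variables and their partial derivatives\<close>

text \<open>
  The polynomial ring over the complex numbers in variables indexed by \<^typ>\<open>'v\<close>, a monomial being
  its exponent vector. The order on \<^typ>\<open>'v\<close> that is assumed below serves only to make this ring an
  instance of \<^class>\<open>idom\<close>.
\<close>

type_synonym 'v mpoly = "('v \<Rightarrow>\<^sub>0 nat) \<Rightarrow>\<^sub>0 complex"

definition Const :: "complex \<Rightarrow> 'v mpoly" where
  "Const c = Poly_Mapping.single 0 c"

definition X :: "'v \<Rightarrow> 'v mpoly" where
  "X i = Poly_Mapping.single (Poly_Mapping.single i 1) 1"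

definition pd :: "'v \<Rightarrow> 'v mpoly \<Rightarrow> 'v mpoly" where
  "pd i p = (\<Sum>m\<in>Poly_Mapping.keys p.
     Poly_Mapping.single (m - Poly_Mapping.single i 1)
       (Poly_Mapping.lookup p m * of_nat (Poly_Mapping.lookup m i)))"

lemma mpoly_induct [case_names zero single add]:
  fixes p :: "'v mpoly"
  assumes "P 0" "\<And>m c. P (Poly_Mapping.single m c)" "\<And>p q. P p \<Longrightarrow> P q \<Longrightarrow> P (p + q)"
  shows "P p"
proof (induction p rule: update_induct)
  case const
  then show ?case by (rule assms)
next
  case (update f a b)
  have "Poly_Mapping.update a b f = f + Poly_Mapping.single a b"
    using update(1)
    by (intro poly_mapping_eqI) (auto simp: lookup_update lookup_add lookup_single in_keys_iff when_def)
  then show ?case using assms update by metis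
qed

lemma pd_superset:
  assumes "finite A" "Poly_Mapping.keys p \<subseteq> A"
  shows "pd i p = (\<Sum>m\<in>A. Poly_Mapping.single (m - Poly_Mapping.single i 1)
       (Poly_Mapping.lookup p m * of_nat (Poly_Mapping.lookup m i)))"
  unfolding pd_def using assms
  by (intro sum.mono_neutral_left) (auto simp: in_keys_iff)

lemma pd_single:
  "pd i (Poly_Mapping.single m c) =
     Poly_Mapping.single (m - Poly_Mapping.single i 1) (c * of_nat (Poly_Mapping.lookup m i))"
  by (subst pd_superset[where A = "{m}"]) auto

lemma pd_zero [simp]: "pd i 0 = 0"
  by (simp add: pd_def)

lemma pd_add: "pd i (p + q) = pd i p + pd i q"
proof -
  let ?A = "Poly_Mapping.keys p \<union> Poly_Mapping.keys q"
  have "finite ?A" "Poly_Mapping.keys (p + q) \<subseteq> ?A" by (auto simp: Poly_Mapping.keys_add)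
  then show ?thesis
    by (simp add: pd_superset[where A = ?A] lookup_add single_add distrib_right sum.distrib)
qed

lemma pd_mult: "pd i (p * q) = pd i p * q + p * pd i q"
proof (induction p rule: mpoly_induct)
  case (single m c)
  show ?case
  proof (induction q rule: mpoly_induct)
    case (single n d)
    let ?e = "Poly_Mapping.single i (1::nat)"
    have 1: "m + n - ?e = m - ?e + n" if "Poly_Mapping.lookup m i \<noteq> 0"
      using that by (intro poly_mapping_eqI)
        (auto simp: lookup_add lookup_minus lookup_single when_def)
    have 2: "m + n - ?e = m + (n - ?e)" if "Poly_Mapping.lookup n i \<noteq> 0"
      using that by (intro poly_mapping_eqI)
        (auto simp: lookup_add lookup_minus lookup_single when_def)
    show ?case
      using 1 2
      by (cases "Poly_Mapping.lookup m i = 0"; cases "Poly_Mapping.lookup n i = 0")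
        (auto simp: pd_single mult_single lookup_add algebra_simps simp flip: single_add)
  qed (simp_all add: pd_add algebra_simps)
qed (simp_all add: pd_add algebra_simps)

lemma pd_commute: "pd i (pd j p) = pd j (pd i p)"
proof (induction p rule: mpoly_induct)
  case (single m c)
  show ?case
  proof (cases "i = j")
    case False
    then have "Poly_Mapping.lookup (m - Poly_Mapping.single j 1) i = Poly_Mapping.lookup m i"
      "Poly_Mapping.lookup (m - Poly_Mapping.single i 1) j = Poly_Mapping.lookup m j"
      by (auto simp: lookup_minus lookup_single)
    moreover have "m - Poly_Mapping.single j 1 - Poly_Mapping.single i (1::nat) =
        m - Poly_Mapping.single i 1 - Poly_Mapping.single j 1"
      by (intro poly_mapping_eqI) (auto simp: lookup_minus)
    ultimately show ?thesis by (simp add: pd_single mult_ac)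
  qed simp
qed (simp_all add: pd_add)

lemma pd_uminus: "pd i (- p) = - pd i p"
  using pd_add[of i p "- p"] by (simp add: eq_neg_iff_add_eq_0 add.commute)

lemma pd_diff: "pd i (p - q) = pd i p - pd i q"
  using pd_add[of i p "- q"] by (simp add: pd_uminus)

lemma pd_one [simp]: "pd i 1 = 0"
  using pd_mult[of i 1 1] by simp


section \<open>Partial derivatives of rational functions\<close>

definition fpd :: "'v::linorder \<Rightarrow> 'v mpoly fract \<Rightarrow> 'v mpoly fract" where
  "fpd i q = (THE r. \<forall>a b. b \<noteq> 0 \<longrightarrow> q = Fract a b \<longrightarrow>
                r = Fract (pd i a * b - a * pd i b) (b * b))"

lemma fpd_Fract:
  fixes a b :: "'v::linorder mpoly"
  assumes "b \<noteq> 0"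
  shows "fpd i (Fract a b) = Fract (pd i a * b - a * pd i b) (b * b)"
  unfolding fpd_def
proof (rule the_equality; clarify?)
  fix a' b' :: "'v mpoly"
  assume b': "b' \<noteq> 0" and "Fract a b = Fract a' b'"
  with assms have *: "a * b' = a' * b" by (simp add: eq_fract)
  then have "pd i (a * b') = pd i (a' * b)" by simp
  then have "pd i a * b' + a * pd i b' = pd i a' * b + a' * pd i b"
    by (simp add: pd_mult)
  with * have "(pd i a * b - a * pd i b) * (b' * b') = (pd i a' * b' - a' * pd i b') * (b * b)"
    by algebra
  with assms b' show "Fract (pd i a * b - a * pd i b) (b * b) =
      Fract (pd i a' * b' - a' * pd i b') (b' * b')"
    by (simp add: eq_fract)
qed (use assms in blast)

lemma fpd_to_fract: "fpd i (to_fract p) = to_fract (pd i p)"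
  by (simp add: to_fract_def fpd_Fract)

lemma fpd_zero [simp]: "fpd i 0 = 0"
  using fpd_to_fract[of i 0] by simp

lemma fpd_one [simp]: "fpd i 1 = 0"
  using fpd_to_fract[of i 1] by simp

lemma fpd_add: "fpd i (p + q) = fpd i p + fpd i q"
proof (induction p; induction q)
  fix a b c d :: "'a mpoly"
  assume "b \<noteq> 0" "d \<noteq> 0"
  then show "fpd i (Fract c d + Fract a b) = fpd i (Fract c d) + fpd i (Fract a b)"
    by (simp add: fpd_Fract eq_fract pd_add pd_mult) algebra
qed

lemma fpd_mult: "fpd i (p * q) = fpd i p * q + p * fpd i q"
proof (induction p; induction q)
  fix a b c d :: "'a mpoly"
  assume "b \<noteq> 0" "d \<noteq> 0"
  then show "fpd i (Fract c d * Fract a b) = fpd i (Fract c d) * Fract a b + Fract c d * fpd i (Fract a b)"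
    by (simp add: fpd_Fract eq_fract pd_mult) algebra
qed

lemma fpd_commute: "fpd i (fpd j p) = fpd j (fpd i p)"
proof (induction p)
  fix a b :: "'a mpoly"
  assume "b \<noteq> 0"
  moreover have "pd i (pd j a) = pd j (pd i a)" "pd i (pd j b) = pd j (pd i b)"
    by (rule pd_commute)+
  ultimately show "fpd i (fpd j (Fract a b)) = fpd j (fpd i (Fract a b))"
    by (simp add: fpd_Fract eq_fract pd_mult pd_diff algebra_simps)
qed


section \<open>The module on the symbol \<open>f\<^sup>s\<close>\<close>

text \<open>
  The element \<open>m f\<^sup>s\<close> is represented by \<open>m\<close>, a polynomial in the indeterminate \<open>s\<close> whose coefficients
  are rational functions. The module over the localized ring is the set \<open>fs_module f\<close> of those \<open>m\<close>
  whose coefficients have a power of \<open>f\<close> as denominator; the symbol \<open>f\<^sup>s\<close> itself is \<open>1\<close>.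
  This set contains \<open>1\<close> and is stable under the action of the Weyl algebra defined below (lemmas
  \<open>one_in_fs_module\<close> and \<open>fs_module_act\<close>), so annihilators may be computed in the larger type.
\<close>

definition fs_module :: "'v::linorder mpoly \<Rightarrow> 'v mpoly fract poly set" where
  "fs_module f = {m. \<forall>j. \<exists>g k. coeff m j = Fract g (f ^ k)}"

text \<open>The partial derivative sends \<open>h f\<^sup>s\<close> to \<open>(\<partial>\<^sub>i h) f\<^sup>s + s h (\<partial>\<^sub>i f / f) f\<^sup>s\<close>.\<close>

definition fs_pd :: "'v::linorder mpoly \<Rightarrow> 'v \<Rightarrow> 'v mpoly fract poly \<Rightarrow> 'v mpoly fract poly" where
  "fs_pd f i m = map_poly (fpd i) m + [:0, to_fract (pd i f) / to_fract f:] * m"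

lemma coeff_fs_pd:
  "coeff (fs_pd f i m) j = fpd i (coeff m j) +
     (if j = 0 then 0 else to_fract (pd i f) / to_fract f * coeff m (j - 1))"
  by (cases j) (auto simp: fs_pd_def coeff_map_poly)

lemma fs_pd_add: "fs_pd f i (m + n) = fs_pd f i m + fs_pd f i n"
  by (rule poly_eqI) (simp add: coeff_fs_pd fpd_add algebra_simps)

lemma fs_pd_smult:
  "fs_pd f i (smult c m) = smult c (fs_pd f i m) + smult (fpd i c) m"
  by (rule poly_eqI) (simp add: coeff_fs_pd fpd_mult algebra_simps)

lemma fpd_log: "fpd i (to_fract (pd j f) / to_fract f) = fpd j (to_fract (pd i f) / to_fract f)"
proof (cases "f = 0")
  case False
  then show ?thesis
    using pd_commute[of i j f]
    by (simp add: fpd_Fract mult_ac flip: Fract_conv_to_fract)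
qed simp

lemma fs_pd_commute: "fs_pd f i (fs_pd f j m) = fs_pd f j (fs_pd f i m)"
proof (rule poly_eqI)
  fix k
  show "coeff (fs_pd f i (fs_pd f j m)) k = coeff (fs_pd f j (fs_pd f i m)) k"
    using fpd_log[of i j f]
    by (simp add: coeff_fs_pd fpd_add fpd_mult fpd_commute[of i j] algebra_simps del: times_divide_eq_left times_divide_eq_right)
qed


section \<open>The Weyl algebra\<close>

text \<open>
  The ring generated by the polynomial ring and by the symbols \<open>\<partial>\<^sub>i\<close> subject to
  \<open>\<partial>\<^sub>i \<partial>\<^sub>j = \<partial>\<^sub>j \<partial>\<^sub>i\<close> and \<open>\<partial>\<^sub>i p = p \<partial>\<^sub>i + (\<partial>p / \<partial>x\<^sub>i)\<close>: the quotient of the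
  noncommutative expressions in these generators by the congruence generated by the ring axioms,
  the identities of the polynomial ring and the two defining relations.
\<close>

datatype 'v wexpr =
    WPoly "'v mpoly"
  | WPartial 'v
  | WAdd "'v wexpr" "'v wexpr"
  | WMul "'v wexpr" "'v wexpr"

inductive weyl_eq :: "'v wexpr \<Rightarrow> 'v wexpr \<Rightarrow> bool" where
  refl: "weyl_eq a a"
| sym: "weyl_eq a b \<Longrightarrow> weyl_eq b a"
| trans: "weyl_eq a b \<Longrightarrow> weyl_eq b c \<Longrightarrow> weyl_eq a c"
| add_cong: "weyl_eq a a' \<Longrightarrow> weyl_eq b b' \<Longrightarrow> weyl_eq (WAdd a b) (WAdd a' b')"
| mul_cong: "weyl_eq a a' \<Longrightarrow> weyl_eq b b' \<Longrightarrow> weyl_eq (WMul a b) (WMul a' b')"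
| add_assoc: "weyl_eq (WAdd (WAdd a b) c) (WAdd a (WAdd b c))"
| add_commute: "weyl_eq (WAdd a b) (WAdd b a)"
| add_0: "weyl_eq (WAdd (WPoly 0) a) a"
| add_neg: "weyl_eq (WAdd (WMul (WPoly (- 1)) a) a) (WPoly 0)"
| mul_assoc: "weyl_eq (WMul (WMul a b) c) (WMul a (WMul b c))"
| mul_1_left: "weyl_eq (WMul (WPoly 1) a) a"
| mul_1_right: "weyl_eq (WMul a (WPoly 1)) a"
| distrib_right: "weyl_eq (WMul (WAdd a b) c) (WAdd (WMul a c) (WMul b c))"
| distrib_left: "weyl_eq (WMul a (WAdd b c)) (WAdd (WMul a b) (WMul a c))"
| poly_add: "weyl_eq (WPoly (p + q)) (WAdd (WPoly p) (WPoly q))"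
| poly_mul: "weyl_eq (WPoly (p * q)) (WMul (WPoly p) (WPoly q))"
| partial_commute: "weyl_eq (WMul (WPartial i) (WPartial j)) (WMul (WPartial j) (WPartial i))"
| partial_poly:
    "weyl_eq (WMul (WPartial i) (WPoly p)) (WAdd (WMul (WPoly p) (WPartial i)) (WPoly (pd i p)))"

primrec fs_act_expr ::
  "'v::linorder mpoly \<Rightarrow> 'v wexpr \<Rightarrow> 'v mpoly fract poly \<Rightarrow> 'v mpoly fract poly" where
  "fs_act_expr f (WPoly p) m = smult (to_fract p) m"
| "fs_act_expr f (WPartial i) m = fs_pd f i m"
| "fs_act_expr f (WAdd a b) m = fs_act_expr f a m + fs_act_expr f b m"
| "fs_act_expr f (WMul a b) m = fs_act_expr f a (fs_act_expr f b m)"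

lemma fs_act_expr_add: "fs_act_expr f a (m + n) = fs_act_expr f a m + fs_act_expr f a n"
  by (induction a arbitrary: m n) (simp_all add: smult_add_right fs_pd_add)

lemma fs_act_expr_respects: "weyl_eq a b \<Longrightarrow> fs_act_expr f a m = fs_act_expr f b m"
proof (induction arbitrary: m rule: weyl_eq.induct)
  case (partial_commute i j)
  show ?case by (simp add: fs_pd_commute)
next
  case (partial_poly i p)
  show ?case by (simp add: fs_pd_smult fpd_to_fract)
qed (simp_all add: fs_act_expr_add smult_add_left)

quotient_type 'v weyl = "'v wexpr" / weyl_eq
  by (auto intro!: equivpI reflpI sympI transpI intro: weyl_eq.refl weyl_eq.sym weyl_eq.trans)

lift_definition weyl_poly :: "'v mpoly \<Rightarrow> 'v weyl" is WPoly .

lift_definition weyl_partial :: "'v \<Rightarrow> 'v weyl" is WPartial .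

text \<open>The action of the Weyl algebra on the module on the symbol \<open>f\<^sup>s\<close>.\<close>

lift_definition fs_act ::
  "'v::linorder mpoly \<Rightarrow> 'v weyl \<Rightarrow> 'v mpoly fract poly \<Rightarrow> 'v mpoly fract poly" is fs_act_expr
  by (auto intro: fs_act_expr_respects)

instantiation weyl :: (linorder) ring_1
begin

lift_definition zero_weyl :: "'a weyl" is "WPoly 0" .
lift_definition one_weyl :: "'a weyl" is "WPoly 1" .
lift_definition plus_weyl :: "'a weyl \<Rightarrow> 'a weyl \<Rightarrow> 'a weyl" is WAdd
  by (rule weyl_eq.add_cong)
lift_definition times_weyl :: "'a weyl \<Rightarrow> 'a weyl \<Rightarrow> 'a weyl" is WMul
  by (rule weyl_eq.mul_cong)
lift_definition uminus_weyl :: "'a weyl \<Rightarrow> 'a weyl" is "WMul (WPoly (- 1))"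
  by (intro weyl_eq.mul_cong weyl_eq.refl)
definition minus_weyl :: "'a weyl \<Rightarrow> 'a weyl \<Rightarrow> 'a weyl" where
  "minus_weyl a b = a + - b"

instance
proof
  fix a b c :: "'a weyl"
  show "a + b + c = a + (b + c)" by transfer (rule weyl_eq.add_assoc)
  show "a + b = b + a" by transfer (rule weyl_eq.add_commute)
  show "0 + a = a" by transfer (rule weyl_eq.add_0)
  show "- a + a = 0" by transfer (rule weyl_eq.add_neg)
  show "a - b = a + - b" by (rule minus_weyl_def)
  show "a * b * c = a * (b * c)" by transfer (rule weyl_eq.mul_assoc)
  show "1 * a = a" by transfer (rule weyl_eq.mul_1_left)
  show "a * 1 = a" by transfer (rule weyl_eq.mul_1_right)
  show "(a + b) * c = a * c + b * c" by transfer (rule weyl_eq.distrib_right)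
  show "a * (b + c) = a * b + a * c" by transfer (rule weyl_eq.distrib_left)
  have "fs_act 1 (0 :: 'a weyl) 1 \<noteq> fs_act 1 1 1" by transfer simp
  then show "(0 :: 'a weyl) \<noteq> 1" by metis
qed

end

lemma weyl_poly_add: "weyl_poly (p + q) = weyl_poly p + weyl_poly q"
  by transfer (rule weyl_eq.poly_add)

lemma weyl_poly_mult: "weyl_poly (p * q) = weyl_poly p * weyl_poly q"
  by transfer (rule weyl_eq.poly_mul)

lemma weyl_poly_0 [simp]: "weyl_poly 0 = 0"
  by (simp add: weyl_poly_def zero_weyl_def)

lemma weyl_poly_1 [simp]: "weyl_poly 1 = 1"
  by (simp add: weyl_poly_def one_weyl_def)

lemma weyl_partial_commute: "weyl_partial i * weyl_partial j = weyl_partial j * weyl_partial i"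
  by transfer (rule weyl_eq.partial_commute)

lemma weyl_partial_poly:
  "weyl_partial i * weyl_poly p = weyl_poly p * weyl_partial i + weyl_poly (pd i p)"
  by transfer (rule weyl_eq.partial_poly)

lemma fs_act_simps:
  "fs_act f (weyl_poly p) m = smult (to_fract p) m"
  "fs_act f (weyl_partial i) m = fs_pd f i m"
  "fs_act f (a + b) m = fs_act f a m + fs_act f b m"
  "fs_act f (a * b) m = fs_act f a (fs_act f b m)"
  "fs_act f 0 m = 0"
  "fs_act f 1 m = m"
  by (transfer; simp)+

lemma fs_act_sum: "fs_act f (\<Sum>i\<in>A. P i) m = (\<Sum>i\<in>A. fs_act f (P i) m)"
  by (induction A rule: infinite_finite_induct) (simp_all add: fs_act_simps)

lemma Fract_power_add:
  assumes "(f :: 'a::idom) \<noteq> 0"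
  shows "\<exists>g' k'. Fract g (f ^ k) + Fract h (f ^ l) = Fract g' (f ^ k')"
  using assms by (auto simp flip: power_add)

lemma fs_module_act_expr:
  assumes "f \<noteq> 0" "m \<in> fs_module f"
  shows "fs_act_expr f a m \<in> fs_module f"
  using assms(2)
proof (induction a arbitrary: m)
  case (WPoly p)
  show ?case unfolding fs_module_def
  proof (clarify)
    fix j
    obtain g k where "coeff m j = Fract g (f ^ k)"
      using WPoly unfolding fs_module_def by blast
    then have "coeff (fs_act_expr f (WPoly p) m) j = Fract (p * g) (f ^ k)"
      by (simp add: to_fract_def)
    then show "\<exists>g k. coeff (fs_act_expr f (WPoly p) m) j = Fract g (f ^ k)" by blast
  qed
next
  case (WPartial i)
  show ?case unfolding fs_module_def
  proof (clarify)
    fix j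
    obtain g k where g: "coeff m j = Fract g (f ^ k)"
      using WPartial unfolding fs_module_def by blast
    obtain h l where h: "coeff m (j - 1) = Fract h (f ^ l)"
      using WPartial unfolding fs_module_def by blast
    have "fpd i (coeff m j) = Fract (pd i g * f ^ k - g * pd i (f ^ k)) (f ^ (k + k))"
      using assms(1) by (simp add: g fpd_Fract power_add)
    moreover have "(if j = 0 then 0 else to_fract (pd i f) / to_fract f * coeff m (j - 1)) =
        Fract (if j = 0 then 0 else pd i f * h) (f ^ Suc l)"
      by (subst h) (simp add: fract_collapse flip: Fract_conv_to_fract)
    ultimately have "coeff (fs_act_expr f (WPartial i) m) j =
        Fract (pd i g * f ^ k - g * pd i (f ^ k)) (f ^ (k + k)) +
        Fract (if j = 0 then 0 else pd i f * h) (f ^ Suc l)"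
      by (simp only: fs_act_expr.simps coeff_fs_pd)
    then show "\<exists>g k. coeff (fs_act_expr f (WPartial i) m) j = Fract g (f ^ k)"
      using Fract_power_add[OF assms(1)] by metis
  qed
next
  case (WAdd a b)
  show ?case unfolding fs_module_def
  proof (clarify)
    fix j
    obtain g k where g: "coeff (fs_act_expr f a m) j = Fract g (f ^ k)"
      using WAdd.IH(1)[OF WAdd.prems] unfolding fs_module_def by blast
    obtain h l where h: "coeff (fs_act_expr f b m) j = Fract h (f ^ l)"
      using WAdd.IH(2)[OF WAdd.prems] unfolding fs_module_def by blast
    have "coeff (fs_act_expr f (WAdd a b) m) j = Fract g (f ^ k) + Fract h (f ^ l)"
      by (simp only: fs_act_expr.simps coeff_add g h)
    then show "\<exists>g k. coeff (fs_act_expr f (WAdd a b) m) j = Fract g (f ^ k)"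
      using Fract_power_add[OF assms(1)] by metis
  qed
next
  case (WMul a b)
  then show ?case by simp
qed

lemma fs_module_act: "f \<noteq> 0 \<Longrightarrow> m \<in> fs_module f \<Longrightarrow> fs_act f P m \<in> fs_module f"
  by (induction P rule: weyl.abs_induct) (simp add: fs_act.abs_eq fs_module_act_expr)

lemma one_in_fs_module: "1 \<in> fs_module f"
proof -
  have "\<exists>g k. coeff (1 :: 'a mpoly fract poly) j = Fract g (f ^ k)" for j
    by (rule exI[of _ "if j = 0 then 1 else 0"], rule exI[of _ 0])
      (auto simp: fract_collapse)
  then show ?thesis by (simp add: fs_module_def)
qed

definition ann_fs :: "'v::linorder mpoly \<Rightarrow> 'v weyl set" where
  "ann_fs f = {P. fs_act f P 1 = 0}"


section \<open>Derivations and the left ideals they generate\<close>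

definition vector_field :: "('v::{finite,linorder} \<Rightarrow> 'v mpoly) \<Rightarrow> 'v weyl" where
  "vector_field a = (\<Sum>i\<in>UNIV. weyl_poly (a i) * weyl_partial i)"

definition apply_vector_field :: "('v::finite \<Rightarrow> 'v mpoly) \<Rightarrow> 'v mpoly \<Rightarrow> 'v mpoly" where
  "apply_vector_field a g = (\<Sum>i\<in>UNIV. a i * pd i g)"

lemma fs_act_vector_field:
  "fs_act f (vector_field a) [:h:] =
     [:\<Sum>i\<in>UNIV. to_fract (a i) * fpd i h,
       h * to_fract (apply_vector_field a f) / to_fract f:]"
proof -
  have sum: "to_fract (\<Sum>i\<in>A. a i * pd i f) = (\<Sum>i\<in>A. to_fract (a i) * to_fract (pd i f))" for A
    by (induction A rule: infinite_finite_induct) simp_all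
  have "fs_act f (weyl_poly (a i) * weyl_partial i) [:h:] =
      [:to_fract (a i) * fpd i h, h * (to_fract (a i) * to_fract (pd i f)) / to_fract f:]" for i
    by (rule poly_eqI) (auto simp: fs_act_simps coeff_fs_pd coeff_pCons split: nat.splits)
  moreover have "(\<Sum>i\<in>A. [:c i, d i:]) = [:sum c A, sum d A:]"
    for A and c d :: "'a \<Rightarrow> 'a mpoly fract"
    by (induction A rule: infinite_finite_induct) simp_all
  ultimately show ?thesis
    by (simp add: vector_field_def apply_vector_field_def fs_act_sum sum sum_distrib_left sum_divide_distrib)
qed

definition left_ideal :: "'a::ring_1 set \<Rightarrow> bool" where
  "left_ideal J \<longleftrightarrow> 0 \<in> J \<and> (\<forall>a\<in>J. \<forall>b\<in>J. a + b \<in> J) \<and> (\<forall>r. \<forall>a\<in>J. r * a \<in> J)"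

lemma fs_act_0_right [simp]: "fs_act f P 0 = 0"
proof (induction P rule: weyl.abs_induct)
  case (1 a)
  have "fs_act_expr f a 0 = fs_act_expr f a 0 + fs_act_expr f a 0"
    using fs_act_expr_add[of f a 0 0] by (simp only: add_0_right)
  then show ?case by (simp only: fs_act.abs_eq add_cancel_right_right)
qed

lemma left_ideal_ann_fs: "left_ideal (ann_fs f)"
  by (simp add: left_ideal_def ann_fs_def fs_act_simps)

definition ann_fs_generated_by_derivations :: "'v::{finite,linorder} mpoly \<Rightarrow> bool" where
  "ann_fs_generated_by_derivations f \<longleftrightarrow>
     ann_fs f = left_ideal hull {vector_field a | a. apply_vector_field a f = 0}"


section \<open>Hyperplane arrangements\<close>

definition affine_hyperplane :: "complex ^ 'n \<Rightarrow> complex \<Rightarrow> (complex ^ 'n) set" where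
  "affine_hyperplane a b = {v. (\<Sum>i\<in>UNIV. a $ i * v $ i) + b = 0}"

definition affine_form :: "complex ^ 'n \<Rightarrow> complex \<Rightarrow> 'n mpoly" where
  "affine_form a b = (\<Sum>i\<in>UNIV. Const (a $ i) * X i) + Const b"

definition hyperplane_arrangement :: "(complex ^ 'n) set set \<Rightarrow> bool" where
  "hyperplane_arrangement A \<longleftrightarrow> finite A \<and> (\<forall>H\<in>A. \<exists>a b. a \<noteq> 0 \<and> H = affine_hyperplane a b)"

definition central_arrangement :: "(complex ^ 'n) set set \<Rightarrow> bool" where
  "central_arrangement A \<longleftrightarrow> hyperplane_arrangement A \<and> (\<forall>H\<in>A. 0 \<in> H)"

text \<open>
  A defining polynomial of an arrangement is a product of degree one polynomials, exactly one for
  each hyperplane; it is unique up to a nonzero constant factor.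
\<close>

definition defining_polynomial :: "(complex ^ 'n) set set \<Rightarrow> 'n mpoly \<Rightarrow> bool" where
  "defining_polynomial A f \<longleftrightarrow>
     (\<exists>a b. (\<forall>H\<in>A. a H \<noteq> 0 \<and> H = affine_hyperplane (a H) (b H)) \<and>
            f = (\<Prod>H\<in>A. affine_form (a H) (b H)))"

end

theory Submission
  imports Defs "HOL-Analysis.Cartesian_Space"
begin

text \<open>
  Put \<open>u = (x\<^sub>1, x\<^sub>2, x\<^sub>3)\<close> and \<open>v = (0, -x\<^sub>0, x\<^sub>0 + x\<^sub>1 + x\<^sub>2 + x\<^sub>3)\<close>. Up to sign, the nine linear
  forms are the differences \<open>u\<^sub>i - v\<^sub>j\<close>, and \<open>u\<close> and \<open>v\<close> have the same sum. So \<open>f\<close> is the resultant of two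
  monic cubics with equal second coefficients, and it has a hidden symmetry under two copies of the symmetric
  group on three letters. Let \<open>s, t\<close> and \<open>p, q\<close> be the nontrivial discrete Fourier coefficients of \<open>u\<close> and
  of \<open>v\<close>. They are coordinates of \<open>\<complex>\<^sup>4\<close> on which this symmetry acts by monomial matrices, and all
  formulas become short in them.

  \<^emph>\<open>The operator.\<close> There are four derivations with cubic coefficients that annihilate \<open>f\<close>. Their symbols, up to
  sign, form a column \<open>A (s, t, p, q)\<^sup>T\<close> with an alternating matrix \<open>A\<close> of symbols that are quadratic in the
  coordinates and linear in the momenta. Since \<open>Pf(A)\<close> times the identity is a matrix multiple of \<open>A\<close>, the product of
  \<open>Pf(A)\<close> with each coordinate lies in the ideal of the symbols of the derivations, although \<open>Pf(A)\<close> itself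
  does not. The operator \<open>pfaffian_op\<close> of order two has the symbol \<open>Pf(A) / 6\<close>. Its product with \<open>s\<close> lies in
  the left ideal of the derivations; the module on \<open>f\<^sup>s\<close> has no torsion, hence the operator annihilates the
  symbol \<open>f\<^sup>s\<close> (lemma \<open>pfaffian_op_in_ann_fs\<close>).

  \<^emph>\<open>The obstruction.\<close> Symbols alone do not decide membership in a left ideal. Instead, a linear
  functional on polynomials is constructed that vanishes on everything of the form \<open>\<delta>\<^sup>T \<phi>\<close>, where \<open>\<delta>\<close> is a
  derivation that annihilates \<open>f\<close> and the transpose is taken with respect to a weight \<open>exp (-h)\<close>, but not on the
  transpose of \<open>pfaffian_op\<close> applied to \<open>1\<close> (lemma \<open>not_generated_by_derivations\<close>). It comes from the module at
  \<open>s = -2/3\<close>. The plane \<open>W\<close> given by \<open>u\<^sub>i = v\<^sub>i\<close> for all \<open>i\<close> lies in three of the hyperplanes, and \<open>f\<close> divided by these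
  three forms restricts to a multiple of \<open>(s\<^sup>3 - t\<^sup>3)\<^sup>2\<close> on \<open>W\<close>. The functional is a regularization of

     \<open>\<phi> \<mapsto> \<integral>\<^sub>W \<phi> (s\<^sup>3 - t\<^sup>3)\<^bsup>-4/3\<^esup> exp (-(s\<^sup>3 - t\<^sup>3))\<close>,

  given by its moments. The density has degree \<open>-4\<close> on a plane, so it is resonant at the origin: the operator
  \<open>E + 4\<close>, with \<open>E\<close> the Euler field of \<open>W\<close>, does not annihilate the regularization but maps it to a second
  derivative of the delta function, which sees the coefficient of \<open>s t\<close> (lemma \<open>integral2_homogeneity\<close>).
  A derivation that annihilates \<open>f\<close> restricts to \<open>c\<^sub>1 E + c\<^sub>2 (t\<^sup>2 \<partial>\<^sub>s + s\<^sup>2 \<partial>\<^sub>t)\<close> on \<open>W\<close>, and its effect on the functional is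
  governed by the coefficient of \<open>s t\<close> in \<open>c\<^sub>1\<close>. This coefficient is zero, because \<open>W\<close> meets three other planes of
  the same kind in lines and there the logarithmic derivatives of \<open>f\<close> have to agree (lemmas \<open>restricted_field\<close> and
  \<open>integral_of_divergence\<close>). For \<open>pfaffian_op\<close> the delta function survives, and the value is \<open>4\<close>.
\<close>


section \<open>Substitution into polynomials\<close>

lemma Const_simps [simp]: "Const 0 = 0" "Const 1 = 1"
  by (simp_all add: Const_def)

lemma Const_hom:
  "Const (a + b) = Const a + Const b" "Const (a * b) = Const a * Const b"
  "Const (- a) = - Const a" "Const (a - b) = Const a - Const b"
  "Const (a ^ n) = Const a ^ n"
proof -
  show mult: "Const (a * b) = Const a * Const b" for a b
    by (simp add: Const_def mult_single)
  show "Const (a + b) = Const a + Const b" "Const (- a) = - Const a" "Const (a - b) = Const a - Const b"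
    by (simp_all add: Const_def single_add single_uminus single_diff)
  show "Const (a ^ n) = Const a ^ n"
    by (induction n) (simp_all add: mult)
qed

lemma Const_numeral: "Const (numeral n) = numeral n"
  by (induction n) (simp_all only: numeral.simps Const_hom Const_simps)

lemma pd_Const [simp]: "pd i (Const c) = 0"
  by (simp add: Const_def pd_single)

lemma pd_X: "pd i (X j) = (if i = j then 1 else 0)"
  by (simp add: X_def pd_single lookup_single when_def)

lemma pd_numeral [simp]: "pd i (numeral n) = 0"
  using pd_Const[of i "numeral n"] by (simp add: Const_numeral)

lemma pd_sum: "pd i (\<Sum>k\<in>A. g k) = (\<Sum>k\<in>A. pd i (g k))"
  by (induction A rule: infinite_finite_induct) (simp_all add: pd_add)

lemma mpoly_ring_induct [case_names const var add mult]:
  fixes p :: "'v mpoly"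
  assumes "\<And>c. P (Const c)" "\<And>i. P (X i)"
    "\<And>p q. P p \<Longrightarrow> P q \<Longrightarrow> P (p + q)" "\<And>p q. P p \<Longrightarrow> P q \<Longrightarrow> P (p * q)"
  shows "P p"
proof (induction p rule: mpoly_induct)
  case zero
  then show ?case using assms(1)[of 0] by simp
next
  case (single m c)
  have power: "P (Poly_Mapping.single (Poly_Mapping.single i n) 1)" for i n
  proof (induction n)
    case 0
    then show ?case using assms(1)[of 1] by simp
  next
    case (Suc n)
    have "Poly_Mapping.single (Poly_Mapping.single i (Suc n)) 1 =
        X i * Poly_Mapping.single (Poly_Mapping.single i n) (1 :: complex)"
      by (simp add: X_def mult_single flip: single_add)
    then show ?case using Suc assms by simp
  qed
  show ?case
  proof (induction m rule: update_induct)
    case const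
    then show ?case using assms(1)[of c] by (simp add: Const_def)
  next
    case (update m i n)
    have "Poly_Mapping.update i n m = m + Poly_Mapping.single i n"
      using update(1)
      by (intro poly_mapping_eqI) (auto simp: lookup_update lookup_add lookup_single in_keys_iff when_def)
    then have "Poly_Mapping.single (Poly_Mapping.update i n m) c =
        Poly_Mapping.single m c * Poly_Mapping.single (Poly_Mapping.single i n) 1"
      by (simp add: mult_single)
    then show ?case using update power assms by simp
  qed
qed (rule assms)

text \<open>
  Sums over the support of a polynomial; substitution and the functional below are both of this form.
\<close>

definition additive_extension :: "('m \<Rightarrow> complex \<Rightarrow> 'b::comm_monoid_add) \<Rightarrow> ('m \<Rightarrow>\<^sub>0 complex) \<Rightarrow> 'b" where
  "additive_extension g p = (\<Sum>m\<in>Poly_Mapping.keys p. g m (Poly_Mapping.lookup p m))"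

lemma additive_extension_single:
  assumes "\<And>m. g m 0 = 0"
  shows "additive_extension g (Poly_Mapping.single m c) = g m c"
  using assms by (simp add: additive_extension_def)

lemma additive_extension_add:
  assumes "\<And>m. g m 0 = 0" "\<And>m a b. g m (a + b) = g m a + g m b"
  shows "additive_extension g (p + q) = additive_extension g p + additive_extension g q"
proof -
  let ?A = "Poly_Mapping.keys p \<union> Poly_Mapping.keys q"
  have *: "additive_extension g r = (\<Sum>m\<in>?A. g m (Poly_Mapping.lookup r m))"
    if "Poly_Mapping.keys r \<subseteq> ?A" for r
    unfolding additive_extension_def using that
    by (intro sum.mono_neutral_left) (auto simp: in_keys_iff assms(1))
  show ?thesis
    by (subst (1 2 3) *) (auto simp: lookup_add assms(2) sum.distrib dest: subsetD[OF Poly_Mapping.keys_add])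
qed

definition subst :: "('v::finite \<Rightarrow> 'w mpoly) \<Rightarrow> 'v mpoly \<Rightarrow> 'w mpoly" where
  "subst \<sigma> = additive_extension (\<lambda>m c. Const c * (\<Prod>i\<in>UNIV. \<sigma> i ^ Poly_Mapping.lookup m i))"

lemma subst_add [simp]: "subst \<sigma> (p + q) = subst \<sigma> p + subst \<sigma> q"
  unfolding subst_def by (rule additive_extension_add) (simp_all add: Const_hom algebra_simps)

lemma subst_single:
  "subst \<sigma> (Poly_Mapping.single m c) = Const c * (\<Prod>i\<in>UNIV. \<sigma> i ^ Poly_Mapping.lookup m i)"
  by (simp add: subst_def additive_extension_single)

lemma subst_Const [simp]: "subst \<sigma> (Const c) = Const c"
  by (subst Const_def) (simp add: subst_single)

lemma subst_0 [simp]: "subst \<sigma> 0 = 0"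
  using subst_Const[of \<sigma> 0] by simp

lemma subst_1 [simp]: "subst \<sigma> 1 = 1"
  using subst_Const[of \<sigma> 1] by simp

lemma subst_X [simp]: "subst \<sigma> (X i) = \<sigma> i"
proof -
  have "(\<Prod>j\<in>UNIV. \<sigma> j ^ Poly_Mapping.lookup (Poly_Mapping.single i 1) j) = (\<Prod>j\<in>UNIV. if j = i then \<sigma> j else 1)"
    by (intro prod.cong) (auto simp: lookup_single when_def)
  then show ?thesis by (simp add: X_def subst_single)
qed

lemma subst_mult [simp]: "subst \<sigma> (p * q) = subst \<sigma> p * subst \<sigma> q"
proof (induction p rule: mpoly_induct)
  case (single m c)
  show ?case
    by (induction q rule: mpoly_induct)
      (simp_all add: mult_single subst_single lookup_add power_add prod.distrib Const_hom algebra_simps)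
qed (simp_all add: algebra_simps)

lemma subst_uminus [simp]: "subst \<sigma> (- p) = - subst \<sigma> p"
  using subst_add[of \<sigma> p "- p"] by (simp add: eq_neg_iff_add_eq_0 add.commute del: subst_add)

lemma subst_diff [simp]: "subst \<sigma> (p - q) = subst \<sigma> p - subst \<sigma> q"
  using subst_add[of \<sigma> p "- q"] by (simp del: subst_add)

lemma subst_sum [simp]: "subst \<sigma> (\<Sum>i\<in>A. g i) = (\<Sum>i\<in>A. subst \<sigma> (g i))"
  by (induction A rule: infinite_finite_induct) simp_all

lemma subst_power [simp]: "subst \<sigma> (p ^ n) = subst \<sigma> p ^ n"
  by (induction n) simp_all

lemma subst_numeral [simp]: "subst \<sigma> (numeral n) = numeral n"
  using subst_Const[of \<sigma> "numeral n"] by (simp add: Const_numeral)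

lemma subst_dvd: "p dvd q \<Longrightarrow> subst \<sigma> p dvd subst \<sigma> q"
  by (metis dvd_def subst_mult)

lemma pd_subst: "pd j (subst \<sigma> p) = (\<Sum>i\<in>UNIV. subst \<sigma> (pd i p) * pd j (\<sigma> i))"
proof (induction p rule: mpoly_ring_induct)
  case (var i)
  have "(\<Sum>k\<in>UNIV. subst \<sigma> (pd k (X i)) * pd j (\<sigma> k)) = (\<Sum>k\<in>UNIV. if k = i then pd j (\<sigma> k) else 0)"
    by (intro sum.cong) (auto simp: pd_X)
  then show ?case by simp
qed (simp_all add: pd_add pd_mult algebra_simps sum.distrib sum_distrib_left)


section \<open>Linear forms and derivations\<close>

definition linear_form :: "('v::finite \<Rightarrow> complex) \<Rightarrow> 'v mpoly" where
  "linear_form a = (\<Sum>i\<in>UNIV. Const (a i) * X i)"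

lemma subst_linear_form: "subst \<sigma> (linear_form a) = (\<Sum>i\<in>UNIV. Const (a i) * \<sigma> i)"
  by (simp add: linear_form_def)

lemma Const_sum: "Const (\<Sum>i\<in>A. g i) = (\<Sum>i\<in>A. Const (g i))"
  by (induction A rule: infinite_finite_induct) (simp_all add: Const_hom)

lemma Const_inject: "Const a = Const b \<longleftrightarrow> a = b"
  unfolding Const_def by (metis lookup_single_eq)

text \<open>
  Both sides of the congruence are ring homomorphisms modulo \<open>h\<close>, so it suffices that they agree on the
  variables.
\<close>

lemma dvd_diff_subst:
  assumes "\<And>i. h dvd X i - \<pi> i"
  shows "h dvd p - subst \<pi> p"
proof (induction p rule: mpoly_ring_induct)
  case (add p q)
  then have "h dvd (p - subst \<pi> p) + (q - subst \<pi> q)" by (rule dvd_add)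
  then show ?case by (simp add: algebra_simps)
next
  case (mult p q)
  have "h dvd (p - subst \<pi> p) * q + subst \<pi> p * (q - subst \<pi> q)"
    using mult by (intro dvd_add dvd_mult dvd_mult2)
  then show ?case by (simp add: algebra_simps)
qed (simp_all add: assms)

text \<open>
  A linear form is prime because reduction modulo it is a ring homomorphism into a domain, namely the
  elimination of a variable that occurs in it.
\<close>

lemma prime_linear_form:
  fixes a :: "'v::{finite,linorder} \<Rightarrow> complex"
  assumes "a \<noteq> (\<lambda>_. 0)"
  shows "prime_elem (linear_form a)"
proof -
  obtain e where e: "a e \<noteq> 0" using assms by blast
  define \<pi> where "\<pi> = X(e := X e - Const (1 / a e) * linear_form a)"
  have "subst \<pi> (linear_form a) = (\<Sum>i\<in>UNIV. Const (a i) * X i -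
      (if i = e then Const (a e) * (Const (1 / a e) * linear_form a) else 0))"
    unfolding subst_linear_form
    by (intro sum.cong) (auto simp: \<pi>_def algebra_simps)
  also have "\<dots> = linear_form a - Const (a e) * Const (1 / a e) * linear_form a"
    by (simp add: sum_subtractf mult.assoc flip: linear_form_def)
  also have "\<dots> = 0" using e by (simp flip: Const_hom(2))
  finally have 0: "subst \<pi> (linear_form a) = 0" .
  have *: "linear_form a dvd p \<longleftrightarrow> subst \<pi> p = 0" for p
  proof
    assume "linear_form a dvd p"
    then show "subst \<pi> p = 0" using subst_dvd[of _ p \<pi>] 0 by fastforce
  next
    assume "subst \<pi> p = 0"
    moreover have "linear_form a dvd p - subst \<pi> p"
      by (rule dvd_diff_subst) (simp add: \<pi>_def)
    ultimately show "linear_form a dvd p" by simp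
  qed
  have "pd e (linear_form a) = (\<Sum>i\<in>UNIV. if i = e then Const (a i) else 0)"
    unfolding linear_form_def pd_sum by (intro sum.cong) (auto simp: pd_mult pd_X)
  also have "\<dots> \<noteq> 0" using e Const_inject[of "a e" 0] by simp
  finally have "linear_form a \<noteq> 0" by auto
  then show ?thesis by (auto simp: prime_elem_def *)
qed

lemma linear_form_not_dvd:
  fixes a b :: "'v::{finite,linorder} \<Rightarrow> complex"
  assumes "(\<Sum>i\<in>UNIV. a i * c i) = 0" "(\<Sum>i\<in>UNIV. b i * c i) \<noteq> 0"
  shows "\<not> linear_form a dvd linear_form b"
proof
  have *: "subst (\<lambda>i. Const (c i)) (linear_form d) = (Const (\<Sum>i\<in>UNIV. d i * c i) :: 'v mpoly)" for d
    by (simp add: subst_linear_form Const_sum Const_hom)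
  assume "linear_form a dvd linear_form b"
  then have "(Const (\<Sum>i\<in>UNIV. a i * c i) :: 'v mpoly) dvd Const (\<Sum>i\<in>UNIV. b i * c i)"
    using subst_dvd[of "linear_form a" "linear_form b" "\<lambda>i. Const (c i) :: 'v mpoly"] by (simp only: *)
  then have "(Const (\<Sum>i\<in>UNIV. b i * c i) :: 'v mpoly) = Const 0" using assms(1) by simp
  then show False using assms(2) Const_inject by blast
qed

lemma vf_add: "apply_vector_field a (p + q) = apply_vector_field a p + apply_vector_field a q"
  by (simp add: apply_vector_field_def pd_add algebra_simps sum.distrib)

lemma vf_mult:
  "apply_vector_field a (p * q) = apply_vector_field a p * q + p * apply_vector_field a q"
  by (simp add: apply_vector_field_def pd_mult algebra_simps sum.distrib sum_distrib_left)

lemma vf_Const [simp]: "apply_vector_field a (Const c) = 0"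
  by (simp add: apply_vector_field_def)

lemma vf_0 [simp]: "apply_vector_field a 0 = 0"
  by (simp add: apply_vector_field_def)

lemma vf_1 [simp]: "apply_vector_field a 1 = 0"
  by (simp add: apply_vector_field_def)

lemma vf_numeral [simp]: "apply_vector_field a (numeral n) = 0"
  by (simp add: apply_vector_field_def)

lemma vf_uminus: "apply_vector_field a (- p) = - apply_vector_field a p"
  by (simp add: apply_vector_field_def pd_uminus sum_negf)

lemma vf_diff: "apply_vector_field a (p - q) = apply_vector_field a p - apply_vector_field a q"
  by (simp add: apply_vector_field_def pd_diff algebra_simps sum_subtractf)

lemma vf_X [simp]: "apply_vector_field a (X i) = a i"
proof -
  have "apply_vector_field a (X i) = (\<Sum>j\<in>UNIV. if j = i then a j else 0)"
    unfolding apply_vector_field_def by (intro sum.cong) (auto simp: pd_X)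
  then show ?thesis by simp
qed

lemma vf_scale: "apply_vector_field (\<lambda>i. q * a i) p = q * apply_vector_field a p"
  by (simp add: apply_vector_field_def sum_distrib_left mult.assoc)

lemmas vf_simps = vf_add vf_diff vf_uminus vf_mult

text \<open>
  Modulo the prime \<open>h i\<close>, the product rule leaves only the term in which \<open>h i\<close> is differentiated, and the
  cofactor in it is not divisible by \<open>h i\<close>. So the derivation is logarithmic along each factor. The sum of
  the \<open>b i\<close> is the logarithmic derivative of the product.
\<close>

lemma logarithmic_derivatives:
  fixes a :: "'v::{finite,linorder} \<Rightarrow> 'v mpoly"
  assumes I: "finite I" and prime: "\<And>i. i \<in> I \<Longrightarrow> prime_elem (h i)"
    and not_dvd: "\<And>i j. i \<in> I \<Longrightarrow> j \<in> I \<Longrightarrow> i \<noteq> j \<Longrightarrow> \<not> h i dvd h j"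
    and zero: "apply_vector_field a (\<Prod>i\<in>I. h i) = 0"
  obtains b where "\<And>i. i \<in> I \<Longrightarrow> apply_vector_field a (h i) = h i * b i" "(\<Sum>i\<in>I. b i) = 0"
proof -
  have "h i dvd apply_vector_field a (h i)" if i: "i \<in> I" for i
  proof -
    let ?g = "\<Prod>j\<in>I - {i}. h j"
    have "(\<Prod>i\<in>I. h i) = h i * ?g" using I i by (rule prod.remove)
    with zero have "apply_vector_field a (h i) * ?g = h i * (- apply_vector_field a ?g)"
      by (simp add: vf_mult eq_neg_iff_add_eq_0)
    then have "h i dvd apply_vector_field a (h i) * ?g" by simp
    moreover have "\<not> h i dvd ?g"
    proof -
      have "\<not> h i dvd (\<Prod>j\<in>J. h j)" if "finite J" "J \<subseteq> I - {i}" for J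
        using that
      proof induction
        case empty
        then show ?case using prime[OF i] by (simp add: prime_elem_def)
      next
        case (insert j J)
        then show ?case using prime_elem_dvd_mult_iff[OF prime[OF i]] not_dvd[OF i] by auto
      qed
      then show ?thesis using I by simp
    qed
    ultimately show ?thesis using prime_elem_dvd_mult_iff[OF prime[OF i]] by blast
  qed
  then have "\<forall>i. \<exists>b. i \<in> I \<longrightarrow> apply_vector_field a (h i) = h i * b" by (auto elim: dvdE)
  then obtain b where b: "\<And>i. i \<in> I \<Longrightarrow> apply_vector_field a (h i) = h i * b i" by metis
  have "apply_vector_field a (\<Prod>i\<in>J. h i) = (\<Sum>i\<in>J. b i) * (\<Prod>i\<in>J. h i)" if "finite J" "J \<subseteq> I" for J
    using that by induction (auto simp: vf_mult b algebra_simps)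
  then have "(\<Sum>i\<in>I. b i) * (\<Prod>i\<in>I. h i) = 0" using I zero by simp
  moreover have "(\<Prod>i\<in>I. h i) \<noteq> 0" using I prime by (auto simp: prime_elem_def)
  ultimately show ?thesis using that b by auto
qed


section \<open>A functional on binary polynomials\<close>

abbreviation S :: "2 mpoly" where "S \<equiv> X 0"
abbreviation T :: "2 mpoly" where "T \<equiv> X 1"

lemma UNIV_2': "(UNIV :: 2 set) = {0, 1}"
  using exhaust_2 by auto (metis zero_neq_one)

lemma sum_2': "(\<Sum>i\<in>UNIV. g (i :: 2)) = g 0 + g 1"
  by (simp add: UNIV_2')

lemma single_eq_monomial:
  "Poly_Mapping.single m c = Const c * S ^ Poly_Mapping.lookup m 0 * T ^ Poly_Mapping.lookup m 1"
proof -
  have power: "X i ^ n = Poly_Mapping.single (Poly_Mapping.single i n) 1" for i :: 2 and n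
    by (induction n) (simp_all add: X_def mult_single flip: single_add)
  have "m = Poly_Mapping.single 0 (Poly_Mapping.lookup m 0) + Poly_Mapping.single 1 (Poly_Mapping.lookup m 1)"
  proof (rule poly_mapping_eqI)
    fix i :: 2
    show "Poly_Mapping.lookup m i = Poly_Mapping.lookup
        (Poly_Mapping.single 0 (Poly_Mapping.lookup m 0) + Poly_Mapping.single 1 (Poly_Mapping.lookup m 1)) i"
      using UNIV_2' by (auto simp: lookup_add lookup_single when_def)
  qed
  then show ?thesis by (simp add: power Const_def mult_single)
qed

lemma binary_induct [case_names zero monomial add]:
  assumes "P 0" "\<And>c a b. P (Const c * S ^ a * T ^ b)" "\<And>p q. P p \<Longrightarrow> P q \<Longrightarrow> P (p + q)"
  shows "P p"
  using assms by (induction p rule: mpoly_induct) (simp_all add: single_eq_monomial)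

text \<open>
  The moments of the density \<open>(s\<^sup>3 - t\<^sup>3)\<^bsup>-4/3\<^esup> exp (-(s\<^sup>3 - t\<^sup>3))\<close>. The density is invariant under the
  field \<open>t\<^sup>2 \<partial>\<^sub>s + s\<^sup>2 \<partial>\<^sub>t\<close>, which annihilates \<open>s\<^sup>3 - t\<^sup>3\<close> and has divergence zero; this fixes the ratios of the
  moments of one degree within a residue class of exponents modulo \<open>3\<close>. The class in which both exponents are \<open>1\<close>
  contains the resonance, and the moments outside this class are set to \<open>0\<close>. Homogeneity
  determines how the moments grow from degree \<open>3 n + 2\<close> to degree \<open>3 n + 5\<close>, by the factor
  \<open>n / (n + 4/3)\<close>. For \<open>n = 0\<close> this recursion breaks down, which is the resonance: the moment of \<open>s t\<close> diverges
  and is set to \<open>0\<close>, and the moments of degree \<open>5\<close> are normalized freely.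
\<close>

definition mom_factor :: "nat \<Rightarrow> complex" where
  "mom_factor n = (if n = 0 then 0 else fact (n - 1) / pochhammer (7 / 3) (n - 1))"

definition moment :: "nat \<Rightarrow> nat \<Rightarrow> complex" where
  "moment a b = (if a mod 3 = 1 \<and> b mod 3 = 1
     then (- 1) ^ (b div 3) * pochhammer (2 / 3) (a div 3) * pochhammer (2 / 3) (b div 3)
       * mom_factor (a div 3 + b div 3) else 0)"

definition integral2 :: "2 mpoly \<Rightarrow> complex" where
  "integral2 = additive_extension (\<lambda>m c. c * moment (Poly_Mapping.lookup m 0) (Poly_Mapping.lookup m 1))"

lemma integral2_add: "integral2 (p + q) = integral2 p + integral2 q"
  unfolding integral2_def by (rule additive_extension_add) (simp_all add: algebra_simps)

lemma integral2_monomial: "integral2 (Const c * S ^ a * T ^ b) = c * moment a b"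
proof -
  let ?m = "Poly_Mapping.single (0 :: 2) a + Poly_Mapping.single 1 b"
  have "Const c * S ^ a * T ^ b = Poly_Mapping.single ?m c"
    by (simp add: single_eq_monomial lookup_add lookup_single)
  then show ?thesis by (simp add: integral2_def additive_extension_single lookup_add lookup_single)
qed

lemma integral2_Const_mult: "integral2 (Const k * p) = k * integral2 p"
proof (induction p rule: binary_induct)
  case (monomial c a b)
  have "Const k * (Const c * S ^ a * T ^ b) = Const (k * c) * S ^ a * T ^ b"
    by (simp add: Const_hom mult.assoc)
  then show ?case by (simp only: integral2_monomial) (simp add: mult.assoc)
next
  case (add p q)
  then show ?case by (simp add: ring_distribs integral2_add)
qed (simp add: integral2_def additive_extension_def)

lemma integral2_diff: "integral2 (p - q) = integral2 p - integral2 q"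
proof -
  have "p = (p - q) + q" by simp
  then have "integral2 p = integral2 (p - q) + integral2 q" by (metis integral2_add)
  then show ?thesis by simp
qed

lemma integral2_0 [simp]: "integral2 0 = 0"
  by (simp add: integral2_def additive_extension_def)

lemma pd_power: "pd i (p ^ Suc n) = of_nat (Suc n) * p ^ n * pd i p"
  by (induction n) (simp_all add: pd_mult algebra_simps)

lemma pd_monomial:
  "pd 0 (Const c * S ^ a * T ^ b) = Const (c * of_nat a) * S ^ (a - 1) * T ^ b"
  "pd 1 (Const c * S ^ a * T ^ b) = Const (c * of_nat b) * S ^ a * T ^ (b - 1)"
proof -
  have nat: "Const (of_nat n) = (of_nat n :: 2 mpoly)" for n
    by (induction n) (simp_all add: Const_hom)
  have *: "pd i (X j ^ n) = (if i = j then Const (of_nat n) * X j ^ (n - 1) else 0)" for i j :: 2 and n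
    by (cases n) (auto simp: pd_power pd_X nat simp del: power_Suc of_nat_Suc)
  show "pd 0 (Const c * S ^ a * T ^ b) = Const (c * of_nat a) * S ^ (a - 1) * T ^ b"
    "pd 1 (Const c * S ^ a * T ^ b) = Const (c * of_nat b) * S ^ a * T ^ (b - 1)"
    by (simp_all add: pd_mult * Const_hom mult_ac)
qed

lemma moment_rotation:
  "of_nat a * moment (a - 1) (b + 2) + of_nat b * moment (a + 2) (b - 1) = 0"
proof (cases "a mod 3 = 2 \<and> b mod 3 = 2")
  case True
  then obtain i j where ij: "a = 3 * i + 2" "b = 3 * j + 2"
    by (metis mult_div_mod_eq)
  have e: "a - 1 = 3 * i + 1" "b - 1 = 3 * j + 1" "a + 2 = 3 * i + 4" "b + 2 = 3 * j + 4"
    by (simp_all add: ij)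
  have *: "(3 * i + 1) div 3 = i" "(3 * i + 1) mod 3 = 1" "(3 * i + 4) div 3 = Suc i"
    "(3 * i + 4) mod 3 = 1" for i :: nat by presburger+
  show ?thesis
    unfolding e unfolding moment_def * by (simp add: ij pochhammer_Suc) (simp add: field_simps)
next
  case False
  have *: "n mod 3 = 2" if "n \<noteq> 0" "(n - 1) mod 3 = 1" for n :: nat
    using that by (cases n) (simp_all add: mod_Suc)
  have **: "n mod 3 = 2" if "(n + 2) mod 3 = 1" for n :: nat
    using that by presburger
  have "a = 0 \<or> moment (a - 1) (b + 2) = 0"
    unfolding moment_def using False *[of a] **[of b] by auto
  moreover have "b = 0 \<or> moment (a + 2) (b - 1) = 0"
    unfolding moment_def using False *[of b] **[of a] by auto
  ultimately show ?thesis by auto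
qed

lemma mom_factor_Suc: "n > 0 \<Longrightarrow> mom_factor (Suc n) * (of_nat n + 4 / 3) = of_nat n * mom_factor n"
proof -
  assume "n > 0"
  then obtain k where k: "n = Suc k" by (cases n) auto
  have nz: "of_nat k + 7 / 3 \<noteq> (0 :: complex)"
  proof
    assume "of_nat k + 7 / 3 = (0 :: complex)"
    then have "Re (of_nat k + 7 / 3) = 0" by simp
    then show False by simp
  qed
  have "mom_factor (Suc (Suc k)) = of_nat (Suc k) * fact k / (pochhammer (7 / 3) k * (of_nat k + 7 / 3))"
    by (simp add: mom_factor_def pochhammer_Suc add.commute)
  moreover have "mom_factor (Suc k) = fact k / pochhammer (7 / 3) k" by (simp add: mom_factor_def)
  moreover have "of_nat (Suc k) + 4 / 3 = (of_nat k + 7 / 3 :: complex)" by simp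
  moreover have "x * f / (p * y) * y = x * (f / p)" if "y \<noteq> 0" for x f p y :: complex
    using that by simp
  ultimately show ?thesis using nz unfolding k by (simp only:)
qed

lemma moment_homogeneity:
  "(2 - of_nat a - of_nat b) * moment a b + 3 * (moment (a + 3) b - moment a (b + 3)) =
     (if a = 1 \<and> b = 1 then 4 else 0)"
proof (cases "a mod 3 = 1 \<and> b mod 3 = 1")
  case True
  then obtain i j where ij: "a = 3 * i + 1" "b = 3 * j + 1"
    by (metis mult_div_mod_eq)
  have *: "(3 * i + 1) div 3 = i" "(3 * i + 1) mod 3 = 1" "(3 * i + 1 + 3) div 3 = Suc i"
    "(3 * i + 1 + 3) mod 3 = 1" for i :: nat by presburger+
  define c where "c = (- 1) ^ j * pochhammer (2 / 3) i * (pochhammer (2 / 3) j :: complex)"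
  have m: "moment a b = c * mom_factor (i + j)"
    "moment (a + 3) b = c * (2 / 3 + of_nat i) * mom_factor (Suc (i + j))"
    "moment a (b + 3) = - c * (2 / 3 + of_nat j) * mom_factor (Suc (i + j))"
    unfolding ij moment_def * by (simp_all add: c_def pochhammer_Suc)
  show ?thesis
  proof (cases "i + j = 0")
    case True
    then show ?thesis unfolding m by (simp add: ij c_def mom_factor_def)
  next
    case False
    then have "mom_factor (Suc (i + j)) * (of_nat i + of_nat j + 4 / 3) = (of_nat i + of_nat j) * mom_factor (i + j)"
      using mom_factor_Suc[of "i + j"] by simp
    moreover have "(2 - of_nat a - of_nat b) * moment a b + 3 * (moment (a + 3) b - moment a (b + 3)) =
        3 * c * (mom_factor (Suc (i + j)) * (of_nat i + of_nat j + 4 / 3) - (of_nat i + of_nat j) * mom_factor (i + j))"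
      unfolding m by (simp add: ij field_simps)
    ultimately show ?thesis using False by (simp add: ij)
  qed
qed (auto simp: moment_def)

text \<open>Invariance under the field that annihilates \<open>s\<^sup>3 - t\<^sup>3\<close>.\<close>

lemma integral2_rotation: "integral2 (T\<^sup>2 * pd 0 p + S\<^sup>2 * pd 1 p) = 0"
proof (induction p rule: binary_induct)
  case (monomial c a b)
  have "T\<^sup>2 * pd 0 (Const c * S ^ a * T ^ b) + S\<^sup>2 * pd 1 (Const c * S ^ a * T ^ b) =
      Const (c * of_nat a) * S ^ (a - 1) * T ^ (b + 2) + Const (c * of_nat b) * S ^ (a + 2) * T ^ (b - 1)"
    unfolding pd_monomial power_add by (simp add: mult_ac)
  then have "integral2 (T\<^sup>2 * pd 0 (Const c * S ^ a * T ^ b) + S\<^sup>2 * pd 1 (Const c * S ^ a * T ^ b)) =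
      c * (of_nat a * moment (a - 1) (b + 2) + of_nat b * moment (a + 2) (b - 1))"
    by (simp only: integral2_add integral2_monomial) (simp add: algebra_simps)
  then show ?case by (simp only: moment_rotation mult_zero_right)
next
  case (add p q)
  have "T\<^sup>2 * pd 0 (p + q) + S\<^sup>2 * pd 1 (p + q) =
      (T\<^sup>2 * pd 0 p + S\<^sup>2 * pd 1 p) + (T\<^sup>2 * pd 0 q + S\<^sup>2 * pd 1 q)"
    by (simp add: pd_add algebra_simps)
  then show ?case
    by (simp only: integral2_add[of "T\<^sup>2 * pd 0 p + S\<^sup>2 * pd 1 p"] add) simp
qed simp

definition coef :: "nat \<Rightarrow> nat \<Rightarrow> 2 mpoly \<Rightarrow> complex" where
  "coef a b p = Poly_Mapping.lookup p (Poly_Mapping.single 0 a + Poly_Mapping.single 1 b)"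

lemma coef_add: "coef a b (p + q) = coef a b p + coef a b q"
  by (simp add: coef_def lookup_add)

lemma coef_monomial: "coef a b (Const c * S ^ i * T ^ j) = (if a = i \<and> b = j then c else 0)"
proof -
  let ?m = "\<lambda>i j. Poly_Mapping.single (0 :: 2) i + Poly_Mapping.single 1 j"
  have "Const c * S ^ i * T ^ j = Poly_Mapping.single (?m i j) c"
    by (simp add: single_eq_monomial lookup_add lookup_single)
  moreover have "?m i j = ?m a b \<longleftrightarrow> a = i \<and> b = j"
  proof
    assume "?m i j = ?m a b"
    then have "Poly_Mapping.lookup (?m i j) k = Poly_Mapping.lookup (?m a b) k" for k by simp
    from this[of 0] this[of 1] show "a = i \<and> b = j" by (simp add: lookup_add lookup_single)
  qed simp
  ultimately show ?thesis by (simp add: coef_def lookup_single when_def)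
qed

lemma coef_0 [simp]: "coef a b 0 = 0"
  by (simp add: coef_def)

lemma coef_mult:
  "coef a b (Const k * p) = k * coef a b p"
  "coef (Suc a) b (S * p) = coef a b p" "coef 0 b (S * p) = 0"
  "coef a (Suc b) (T * p) = coef a b p" "coef a 0 (T * p) = 0"
proof (induction p arbitrary: a b rule: binary_induct)
  case (monomial c i j)
  have *: "Const k * (Const c * S ^ i * T ^ j) = Const (k * c) * S ^ i * T ^ j"
    "S * (Const c * S ^ i * T ^ j) = Const c * S ^ Suc i * T ^ j"
    "T * (Const c * S ^ i * T ^ j) = Const c * S ^ i * T ^ Suc j"
    by (simp_all add: Const_hom mult_ac)
  {
    case 1 show ?case unfolding * coef_monomial by simp
  next
    case 2 show ?case unfolding * coef_monomial by simp
  next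
    case 3 show ?case unfolding * coef_monomial by simp
  next
    case 4 show ?case unfolding * coef_monomial by simp
  next
    case 5 show ?case unfolding * coef_monomial by simp
  }
next
  case (add p q)
  {
    case 1 show ?case by (simp only: ring_distribs coef_add add)
  next
    case 2 show ?case by (simp only: ring_distribs coef_add add)
  next
    case 3 show ?case by (simp only: ring_distribs coef_add add) simp
  next
    case 4 show ?case by (simp only: ring_distribs coef_add add)
  next
    case 5 show ?case by (simp only: ring_distribs coef_add add) simp
  }
qed simp_all

text \<open>
  The transpose of \<open>E + 4\<close> with respect to the weight \<open>exp (-(s\<^sup>3 - t\<^sup>3))\<close> is \<open>2 - E + 3 (s\<^sup>3 - t\<^sup>3)\<close>. The right-hand
  side is the anomaly that the regularization of the moment of \<open>s t\<close> leaves behind.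
\<close>

lemma integral2_homogeneity:
  "integral2 (2 * p - (S * pd 0 p + T * pd 1 p) + 3 * (S ^ 3 - T ^ 3) * p) = 4 * coef 1 1 p"
proof (induction p rule: binary_induct)
  case (monomial c a b)
  let ?p = "Const c * S ^ a * T ^ b"
  have "S * pd 0 ?p = Const (c * of_nat a) * S ^ a * T ^ b" "T * pd 1 ?p = Const (c * of_nat b) * S ^ a * T ^ b"
    unfolding pd_monomial by (cases a; cases b; simp add: mult_ac)+
  moreover have "2 * ?p = Const 2 * ?p" "3 * (S ^ 3 - T ^ 3) * ?p =
      Const 3 * ((Const c * S ^ (a + 3) * T ^ b) - (Const c * S ^ a * T ^ (b + 3)))"
    by (simp_all add: Const_numeral power_add algebra_simps)
  ultimately have "integral2 (2 * ?p - (S * pd 0 ?p + T * pd 1 ?p) + 3 * (S ^ 3 - T ^ 3) * ?p) =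
      c * ((2 - of_nat a - of_nat b) * moment a b + 3 * (moment (a + 3) b - moment a (b + 3)))"
    by (simp only: integral2_add integral2_diff integral2_Const_mult integral2_monomial)
      (simp add: algebra_simps)
  then show ?case by (simp only: moment_homogeneity coef_monomial) auto
next
  case (add p q)
  have "2 * (p + q) - (S * pd 0 (p + q) + T * pd 1 (p + q)) + 3 * (S ^ 3 - T ^ 3) * (p + q) =
      (2 * p - (S * pd 0 p + T * pd 1 p) + 3 * (S ^ 3 - T ^ 3) * p) +
      (2 * q - (S * pd 0 q + T * pd 1 q) + 3 * (S ^ 3 - T ^ 3) * q)"
    by (simp add: pd_add algebra_simps)
  then show ?case
    by (simp only: integral2_add[of "2 * p - (S * pd 0 p + T * pd 1 p) + 3 * (S ^ 3 - T ^ 3) * p"]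
        add coef_add) simp
qed simp

text \<open>The value of the functional that will separate \<open>pfaffian_op\<close> from the derivations.\<close>

lemma integral2_witness:
  "integral2 (12 * (S * T * (S ^ 3 - T ^ 3)) - 9 * (S * T * (S ^ 3 - T ^ 3)\<^sup>2)) = 4"
proof -
  have "12 * (S * T * (S ^ 3 - T ^ 3)) - 9 * (S * T * (S ^ 3 - T ^ 3)\<^sup>2) =
     (Const 12 * S ^ 4 * T ^ 1 - Const 12 * S ^ 1 * T ^ 4) -
     ((Const 9 * S ^ 7 * T ^ 1 - Const 18 * S ^ 4 * T ^ 4) + Const 9 * S ^ 1 * T ^ 7)"
    by (simp add: Const_numeral eval_nat_numeral algebra_simps)
  then have "integral2 (12 * (S * T * (S ^ 3 - T ^ 3)) - 9 * (S * T * (S ^ 3 - T ^ 3)\<^sup>2)) =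
     (12 * moment 4 1 - 12 * moment 1 4) - ((9 * moment 7 1 - 18 * moment 4 4) + 9 * moment 1 7)"
    by (simp only: integral2_add integral2_diff integral2_monomial)
  also have "\<dots> = 4"
  proof -
    have "pochhammer (2 / 3 :: complex) 0 = 1" "pochhammer (2 / 3 :: complex) 1 = 2 / 3"
      "pochhammer (2 / 3 :: complex) 2 = 10 / 9"
      by (simp_all add: pochhammer_Suc eval_nat_numeral)
    moreover have "mom_factor 1 = 1" "mom_factor 2 = 3 / 7"
      by (simp_all add: mom_factor_def)
    moreover have "(7 :: nat) div 3 = 2" "(4 :: nat) div 3 = 1" "(1 :: nat) div 3 = 0"
      "(7 :: nat) mod 3 = 1" "(4 :: nat) mod 3 = 1" "(1 :: nat) mod 3 = 1" "(1 :: nat) + 0 = 1"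
      "(0 :: nat) + 1 = 1" "(2 :: nat) + 0 = 2" "(0 :: nat) + 2 = 2" "(1 :: nat) + 1 = 2"
      by simp_all
    ultimately have "moment 4 1 = 2 / 3" "moment 1 4 = - 2 / 3" "moment 7 1 = 10 / 21"
      "moment 4 4 = - 4 / 21" "moment 1 7 = 10 / 21"
      unfolding moment_def by (simp_all only:) simp_all
    then show ?thesis by (simp only:) simp
  qed
  finally show ?thesis .
qed


section \<open>The Weyl algebra acting from the right on polynomials\<close>

text \<open>
  The adjoint with respect to the formal pairing \<open>\<integral> \<phi> \<psi> exp (-h)\<close>: multiplications are self-adjoint, and
  integration by parts turns \<open>\<partial>\<^sub>i\<close> into \<open>\<phi> \<mapsto> (\<partial>\<^sub>i h) \<phi> - \<partial>\<^sub>i \<phi>\<close>. The order of products is reversed.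
\<close>

primrec transpose_expr :: "'v mpoly \<Rightarrow> 'v wexpr \<Rightarrow> 'v mpoly \<Rightarrow> 'v mpoly" where
  "transpose_expr h (WPoly p) q = p * q"
| "transpose_expr h (WPartial i) q = pd i h * q - pd i q"
| "transpose_expr h (WAdd a b) q = transpose_expr h a q + transpose_expr h b q"
| "transpose_expr h (WMul a b) q = transpose_expr h b (transpose_expr h a q)"

lemma transpose_expr_add: "transpose_expr h a (p + q) = transpose_expr h a p + transpose_expr h a q"
  by (induction a arbitrary: p q) (simp_all add: pd_add algebra_simps)

lemma transpose_expr_respects: "weyl_eq a b \<Longrightarrow> transpose_expr h a q = transpose_expr h b q"
proof (induction arbitrary: q rule: weyl_eq.induct)
  case (add_neg a)
  show ?case using transpose_expr_add[of h a "- q" q] transpose_expr_add[of h a 0 0] by (simp add: add.commute)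
next
  case (partial_commute i j)
  show ?case by (simp add: pd_mult pd_diff pd_commute algebra_simps)
qed (simp_all add: transpose_expr_add pd_mult algebra_simps)

lift_definition weyl_transpose :: "'v mpoly \<Rightarrow> 'v weyl \<Rightarrow> 'v mpoly \<Rightarrow> 'v mpoly" is transpose_expr
  by (rule ext) (rule transpose_expr_respects)

lemma transpose_simps:
  "weyl_transpose h (weyl_poly p) q = p * q"
  "weyl_transpose h (weyl_partial i) q = pd i h * q - pd i q"
  "weyl_transpose h (a + b) q = weyl_transpose h a q + weyl_transpose h b q"
  "weyl_transpose h (a * b) q = weyl_transpose h b (weyl_transpose h a q)"
  "weyl_transpose h 0 q = 0"
  by (transfer; simp)+

lemma transpose_sum: "weyl_transpose h (\<Sum>i\<in>A. P i) q = (\<Sum>i\<in>A. weyl_transpose h (P i) q)"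
  by (induction A rule: infinite_finite_induct) (simp_all add: transpose_simps)

lemma transpose_vector_field:
  "weyl_transpose h (vector_field a) q = (\<Sum>i\<in>UNIV. pd i h * (a i * q) - pd i (a i * q))"
  by (simp add: vector_field_def transpose_sum transpose_simps)

lemma transpose_constant_field:
  assumes "\<And>i. a i = Const (c i)"
  shows "weyl_transpose h (vector_field a) q = apply_vector_field a h * q - apply_vector_field a q"
proof -
  have "weyl_transpose h (vector_field a) q = (\<Sum>i\<in>UNIV. Const (c i) * pd i h * q - Const (c i) * pd i q)"
    by (simp add: transpose_vector_field assms pd_mult mult_ac)
  then show ?thesis by (simp add: apply_vector_field_def assms sum_subtractf sum_distrib_right)
qed

text \<open>
  The operators that annihilate \<open>u\<close> when \<open>u\<close> is regarded as a distribution. They form a left ideal because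
  the transpose reverses products.
\<close>

definition transpose_kernel :: "'v::linorder mpoly \<Rightarrow> ('v mpoly \<Rightarrow> complex) \<Rightarrow> 'v weyl set" where
  "transpose_kernel h u = {P. \<forall>q. u (weyl_transpose h P q) = 0}"

lemma left_ideal_transpose_kernel:
  assumes "\<And>p q. u (p + q) = u p + u q" "u 0 = 0"
  shows "left_ideal (transpose_kernel h u)"
  using assms by (simp add: left_ideal_def transpose_kernel_def transpose_simps)

text \<open>
  The condition on the derivations is only imposed for the test function \<open>1\<close>: a polynomial multiple of a
  derivation that annihilates \<open>f\<close> annihilates \<open>f\<close> as well, and takes care of the other test functions.
\<close>

lemma not_generated_by_derivations:
  fixes u :: "'v::{finite,linorder} mpoly \<Rightarrow> complex"
  assumes "\<And>p q. u (p + q) = u p + u q" "u 0 = 0"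
    and "\<And>a. apply_vector_field a f = 0 \<Longrightarrow> u (\<Sum>i\<in>UNIV. pd i h * a i - pd i (a i)) = 0"
    and "P \<in> ann_fs f" "u (weyl_transpose h P 1) \<noteq> 0"
  shows "\<not> ann_fs_generated_by_derivations f"
proof
  assume "ann_fs_generated_by_derivations f"
  then have P: "P \<in> left_ideal hull {vector_field a | a. apply_vector_field a f = 0}"
    using assms(4) by (simp add: ann_fs_generated_by_derivations_def)
  have "vector_field a \<in> transpose_kernel h u" if "apply_vector_field a f = 0" for a
  proof -
    have "u (weyl_transpose h (vector_field a) q) = 0" for q
    proof -
      have "apply_vector_field (\<lambda>i. q * a i) f = 0" by (simp add: vf_scale that)
      then show ?thesis using assms(3) by (simp add: transpose_vector_field mult.commute[of q])
    qed
    then show ?thesis by (simp add: transpose_kernel_def)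
  qed
  then have "left_ideal hull {vector_field a | a. apply_vector_field a f = 0} \<subseteq> transpose_kernel h u"
    using left_ideal_transpose_kernel[of u h] assms(1,2) by (intro hull_minimal) auto
  with P assms(5) show False by (auto simp: transpose_kernel_def)
qed


section \<open>Second order operators acting on the symbol\<close>

definition second_order ::
  "'v::{finite,linorder} mpoly \<Rightarrow> ('v \<Rightarrow> 'v mpoly) \<Rightarrow> ('v \<Rightarrow> 'v mpoly) \<Rightarrow> 'v weyl" where
  "second_order c a b = weyl_poly c * vector_field a * vector_field b"

text \<open>
  The coefficients of \<open>s\<close> and of \<open>s\<^sup>2\<close> are cleared of denominators, so that the vanishing of a sum of such terms
  becomes two identities between polynomials.
\<close>

lemma fs_act_second_order:
  fixes f :: "'v::{finite,linorder} mpoly"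
  assumes "f \<noteq> 0"
  shows "fs_act f (second_order c a b) 1 =
    [:0, to_fract (c * (apply_vector_field a (apply_vector_field b f) * f
           - apply_vector_field a f * apply_vector_field b f)) / to_fract (f * f),
      to_fract (c * (apply_vector_field a f * apply_vector_field b f)) / to_fract (f * f):]"
proof -
  have sum: "to_fract (\<Sum>i\<in>A. g i) = (\<Sum>i\<in>A. to_fract (g i))" for A and g :: "'v \<Rightarrow> 'v mpoly"
    by (induction A rule: infinite_finite_induct) simp_all
  let ?d = "\<lambda>q. \<Sum>i\<in>UNIV. to_fract (a i) * fpd i q"
  let ?L = "to_fract (apply_vector_field b f) / to_fract f"
  have "fs_act f (vector_field b) 1 = [:0, ?L:]"
    using fs_act_vector_field[of f b 1] by (simp add: one_pCons)
  moreover have "fs_act f (vector_field a) [:0, ?L:] = [:0, ?d ?L, to_fract (apply_vector_field a f) / to_fract f * ?L:]"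
  proof (rule poly_eqI)
    fix j
    have "coeff (fs_act f (vector_field a) [:0, ?L:]) j = (\<Sum>i\<in>UNIV. to_fract (a i) *
        (fpd i (coeff [:0, ?L:] j) + (if j = 0 then 0 else to_fract (pd i f) / to_fract f * coeff [:0, ?L:] (j - 1))))"
      by (simp add: vector_field_def fs_act_sum fs_act_simps coeff_sum coeff_fs_pd)
    also have "\<dots> = coeff [:0, ?d ?L, to_fract (apply_vector_field a f) / to_fract f * ?L:] j"
      by (auto simp: coeff_pCons apply_vector_field_def[of a f] sum sum_distrib_right sum_divide_distrib mult.assoc split: nat.splits)
    finally show "coeff (fs_act f (vector_field a) [:0, ?L:]) j =
        coeff [:0, ?d ?L, to_fract (apply_vector_field a f) / to_fract f * ?L:] j" .
  qed
  moreover have "?d ?L = to_fract (apply_vector_field a (apply_vector_field b f) * f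
      - apply_vector_field a f * apply_vector_field b f) / to_fract (f * f)"
  proof -
    have "fpd i ?L = to_fract (pd i (apply_vector_field b f) * f - apply_vector_field b f * pd i f) / to_fract (f * f)" for i
      unfolding Fract_conv_to_fract[symmetric] using assms by (rule fpd_Fract)
    then have "?d ?L = (\<Sum>i\<in>UNIV. to_fract (a i * (pd i (apply_vector_field b f) * f - apply_vector_field b f * pd i f)) / to_fract (f * f))"
      by simp
    also have "\<dots> = to_fract (\<Sum>i\<in>UNIV. a i * (pd i (apply_vector_field b f) * f - apply_vector_field b f * pd i f)) / to_fract (f * f)"
      by (simp only: sum sum_divide_distrib)
    also have "(\<Sum>i\<in>UNIV. a i * (pd i (apply_vector_field b f) * f - apply_vector_field b f * pd i f)) =
        apply_vector_field a (apply_vector_field b f) * f - apply_vector_field a f * apply_vector_field b f"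
      unfolding apply_vector_field_def[of a]
      by (simp add: algebra_simps sum_subtractf sum_distrib_left sum_distrib_right)
    finally show ?thesis .
  qed
  ultimately show ?thesis
    by (simp add: second_order_def fs_act_simps)
qed


section \<open>Polynomial identities\<close>

text \<open>
  The computations in the coordinates \<open>s, t, p, q\<close>, stated over an arbitrary domain. Throughout, \<open>z\<close> plays
  the role of a primitive cube root of unity and \<open>c\<close> that of \<open>1/3\<close>.
\<close>

lemma inverse_coordinates_identity:
  fixes z c :: "'a::idom"
  assumes z: "z\<^sup>2 + z + 1 = 0" and c: "3 * c = 1"
    and s: "s = c * (x + z\<^sup>2 * y + z * u)" and t: "t = c * (x + z * y + z\<^sup>2 * u)"
    and p: "p = c * (z * (w + x + y + u) - z\<^sup>2 * w)" and q: "q = c * (z\<^sup>2 * (w + x + y + u) - z * w)"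
  shows "w = (1 - z) * p + (1 - z\<^sup>2) * q" "x = s + t - p - q"
    "y = z * s + z\<^sup>2 * t - p - q" "u = z\<^sup>2 * s + z * t - p - q"
  unfolding s t p q using z c by algebra+

lemma dual_coordinates_identity:
  fixes z c :: "'a::idom"
  assumes "z\<^sup>2 + z + 1 = 0" "3 * c = 1"
  shows
    "c * (1 + z\<^sup>2 * z + z * z\<^sup>2) = 1" "c * (1 + z * z + z\<^sup>2 * z\<^sup>2) = 0" "c * (z * (0 + 1 + z + z\<^sup>2) - z\<^sup>2 * 0) = 0" "c * (z\<^sup>2 * (0 + 1 + z + z\<^sup>2) - z * 0) = 0"
    "c * (1 + z\<^sup>2 * z\<^sup>2 + z * z) = 0" "c * (1 + z * z\<^sup>2 + z\<^sup>2 * z) = 1" "c * (z * (0 + 1 + z\<^sup>2 + z) - z\<^sup>2 * 0) = 0" "c * (z\<^sup>2 * (0 + 1 + z\<^sup>2 + z) - z * 0) = 0"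
    "c * ((- 1) + z\<^sup>2 * (- 1) + z * (- 1)) = 0" "c * ((- 1) + z * (- 1) + z\<^sup>2 * (- 1)) = 0" "c * (z * ((1 - z) + (- 1) + (- 1) + (- 1)) - z\<^sup>2 * (1 - z)) = 1" "c * (z\<^sup>2 * ((1 - z) + (- 1) + (- 1) + (- 1)) - z * (1 - z)) = 0"
    "c * ((- 1) + z\<^sup>2 * (- 1) + z * (- 1)) = 0" "c * ((- 1) + z * (- 1) + z\<^sup>2 * (- 1)) = 0" "c * (z * ((1 - z\<^sup>2) + (- 1) + (- 1) + (- 1)) - z\<^sup>2 * (1 - z\<^sup>2)) = 0" "c * (z\<^sup>2 * ((1 - z\<^sup>2) + (- 1) + (- 1) + (- 1)) - z * (1 - z\<^sup>2)) = 1"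
  using assms by algebra+

text \<open>
  The variables \<open>w, x, y, u\<close> stand for \<open>x\<^sub>0, x\<^sub>1, x\<^sub>2, x\<^sub>3\<close>. The left-hand sides are products of three of the nine forms: those
  which contain the same \<open>u\<^sub>i\<close>. Up to sign they are the values of the cubic with roots \<open>v\<close> at the roots of
  the other cubic. Subtracting the other cubic makes them linear in the root.
\<close>

lemma cubic_identity:
  fixes z :: "'a::idom"
  assumes z: "z\<^sup>2 + z + 1 = 0"
    and w: "w = (1 - z) * p + (1 - z\<^sup>2) * q" and x: "x = s + t - p - q"
    and y: "y = z * s + z\<^sup>2 * t - p - q" and u: "u = z\<^sup>2 * s + z * t - p - q"
  shows "x * (x + w) * (y + u + w) = p^3 + q^3 - s^3 - t^3 - 3 * (s * t - p * q) * (s + t)"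
    "y * (y + w) * (x + u + w) = p^3 + q^3 - s^3 - t^3 - 3 * (s * t - p * q) * (z * s + z\<^sup>2 * t)"
    "u * (u + w) * (x + y + w) = p^3 + q^3 - s^3 - t^3 - 3 * (s * t - p * q) * (z\<^sup>2 * s + z * t)"
  unfolding w x y u using z by algebra+

lemma resultant_identity:
  fixes z :: "'a::idom"
  assumes z: "z\<^sup>2 + z + 1 = 0"
  shows "(g - d * (s + t)) * (g - d * (z * s + z\<^sup>2 * t)) * (g - d * (z\<^sup>2 * s + z * t)) =
    g^3 - 3 * s * t * d\<^sup>2 * g - (s^3 + t^3) * d^3"
  using z by algebra

lemma logarithmic_identities:
  fixes s t p q :: "'a::idom"
  assumes d: "d = 3 * (s * t - p * q)" and g: "g = p^3 + q^3 - s^3 - t^3"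
    and Fs: "Fs = (3 * g\<^sup>2 - 3 * s * t * d\<^sup>2) * (- 3 * s\<^sup>2) - (6 * s * t * d * g + 3 * (s^3 + t^3) * d\<^sup>2) * (3 * t)
               - 3 * t * d\<^sup>2 * g - 3 * s\<^sup>2 * d^3"
    and Ft: "Ft = (3 * g\<^sup>2 - 3 * s * t * d\<^sup>2) * (- 3 * t\<^sup>2) - (6 * s * t * d * g + 3 * (s^3 + t^3) * d\<^sup>2) * (3 * s)
               - 3 * s * d\<^sup>2 * g - 3 * t\<^sup>2 * d^3"
    and Fp: "Fp = (3 * g\<^sup>2 - 3 * s * t * d\<^sup>2) * (3 * p\<^sup>2) - (6 * s * t * d * g + 3 * (s^3 + t^3) * d\<^sup>2) * (- 3 * q)"
    and Fq: "Fq = (3 * g\<^sup>2 - 3 * s * t * d\<^sup>2) * (3 * q\<^sup>2) - (6 * s * t * d * g + 3 * (s^3 + t^3) * d\<^sup>2) * (- 3 * p)"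
  shows "(6 * t * p * q - t\<^sup>2 * s) * Fs + (s^3 + 2 * p^3 + 2 * q^3) * Ft
     + (3 * s * q\<^sup>2 + 2 * t\<^sup>2 * p) * Fp + (3 * s * p\<^sup>2 + 2 * t\<^sup>2 * q) * Fq = 0"
  "(3 * q * t\<^sup>2 + 2 * p\<^sup>2 * s) * Fs + (3 * q * s\<^sup>2 + 2 * p\<^sup>2 * t) * Ft
     + (q^3 + 2 * s^3 + 2 * t^3) * Fp + (6 * p * s * t - p\<^sup>2 * q) * Fq = 0"
  "(3 * p * t\<^sup>2 + 2 * q\<^sup>2 * s) * Fs + (3 * p * s\<^sup>2 + 2 * q\<^sup>2 * t) * Ft
     + (6 * q * s * t - q\<^sup>2 * p) * Fp + (p^3 + 2 * s^3 + 2 * t^3) * Fq = 0"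
  unfolding Fs Ft Fp Fq unfolding d g by algebra+

text \<open>
  The identity \<open>s Pf(A) = - (A\<^sub>3\<^sub>4 g\<^sub>2 - A\<^sub>2\<^sub>4 g\<^sub>3 + A\<^sub>2\<^sub>3 g\<^sub>4)\<close> for \<open>g = A (s, t, p, q)\<^sup>T\<close> with an alternating matrix \<open>A\<close>, where
  the momenta are the partial derivatives of \<open>f\<close>. The three products on the right are the entries of \<open>A\<close> times
  the derivations.
\<close>

lemma pfaffian_identity:
  fixes s t p q Fs Ft Fp Fq :: "'a::idom"
  shows "- 6 * s * (- (t * (p^3 - q^3)) * (Fs * Fs) + s * (p^3 - q^3) * (Ft * Ft)
    + - (q * (s^3 - t^3)) * (Fp * Fp) + p * (s^3 - t^3) * (Fq * Fq)
    + (2 * t\<^sup>2 * q\<^sup>2 - s * p\<^sup>2 * q - s\<^sup>2 * t * p) * (Fs * Fp)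
    + (s * p * q\<^sup>2 + s\<^sup>2 * t * q - 2 * t\<^sup>2 * p\<^sup>2) * (Fs * Fq)
    + (s * t\<^sup>2 * p + t * p\<^sup>2 * q - 2 * s\<^sup>2 * q\<^sup>2) * (Ft * Fp)
    + (2 * s\<^sup>2 * p\<^sup>2 - s * t\<^sup>2 * q - t * p * q\<^sup>2) * (Ft * Fq)) =
      (p\<^sup>2 * Fq - q\<^sup>2 * Fp) * ((6 * t * p * q - t\<^sup>2 * s) * Fs + (s^3 + 2 * p^3 + 2 * q^3) * Ft
        + (3 * s * q\<^sup>2 + 2 * t\<^sup>2 * p) * Fp + (3 * s * p\<^sup>2 + 2 * t\<^sup>2 * q) * Fq)
      + (2 * q\<^sup>2 * Ft + 2 * t\<^sup>2 * Fq + 3 * t * p * Fs + 3 * s * q * Fp) *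
        ((3 * q * t\<^sup>2 + 2 * p\<^sup>2 * s) * Fs + (3 * q * s\<^sup>2 + 2 * p\<^sup>2 * t) * Ft
          + (q^3 + 2 * s^3 + 2 * t^3) * Fp + (6 * p * s * t - p\<^sup>2 * q) * Fq)
      - (2 * p\<^sup>2 * Ft + 2 * t\<^sup>2 * Fp + 3 * t * q * Fs + 3 * s * p * Fq) *
        ((3 * p * t\<^sup>2 + 2 * q\<^sup>2 * s) * Fs + (3 * p * s\<^sup>2 + 2 * q\<^sup>2 * t) * Ft
          + (6 * q * s * t - q\<^sup>2 * p) * Fp + (p^3 + 2 * s^3 + 2 * t^3) * Fq)"
  by algebra

lemma restricted_coordinates_identity:
  fixes z c :: "'a::idom"
  assumes "z\<^sup>2 + z + 1 = 0" "3 * c = 1" "w = (1 - z) * x + (1 - z\<^sup>2) * y" "u = (z\<^sup>2 - 1) * x + (z - 1) * y"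
  shows "c * (0 + z\<^sup>2 * (- w) + z * u) = x" "c * (0 + z * (- w) + z\<^sup>2 * u) = y"
    "c * (z * (w + 0 + - w + u) - z\<^sup>2 * w) = x" "c * (z\<^sup>2 * (w + 0 + - w + u) - z * w) = y"
  using assms by algebra+

lemma tangential_components_identity:
  fixes z c :: "'a::idom"
  assumes "z\<^sup>2 + z + 1 = 0" "3 * c = 1"
    "w = (1 - z) * x + (1 - z\<^sup>2) * y" "u = (z\<^sup>2 - 1) * x + (z - 1) * y"
  shows "c * (0 + z\<^sup>2 * (- (w * (c1 - c2 * (z\<^sup>2 * x + z * y)))) + z * (u * (c1 - c2 * (z * x + z\<^sup>2 * y)))) = c1 * x + c2 * y\<^sup>2"
    "c * (0 + z * (- (w * (c1 - c2 * (z\<^sup>2 * x + z * y)))) + z\<^sup>2 * (u * (c1 - c2 * (z * x + z\<^sup>2 * y)))) = c1 * y + c2 * x\<^sup>2"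
  using assms by algebra+

text \<open>
  The divergence of a field on the plane \<open>W\<close>, computed from its components \<open>w (c\<^sub>1 - c\<^sub>2 (z\<^sup>2 x + z y))\<close> and
  \<open>u (c\<^sub>1 - c\<^sub>2 (z x + z\<^sup>2 y))\<close> along the linear coordinates \<open>w, u\<close>. The premises are the chain rule for \<open>x\<close> and
  \<open>y\<close>. In the coordinates \<open>x, y\<close> the field is \<open>c\<^sub>1 E + c\<^sub>2 (y\<^sup>2 \<partial>\<^sub>x + x\<^sup>2 \<partial>\<^sub>y)\<close>.
\<close>

lemma divergence_identity:
  fixes z :: "'a::idom"
  assumes z: "z\<^sup>2 + z + 1 = 0" and z0: "3 * (z\<^sup>2 - z) \<noteq> 0"
    and w: "w = (1 - z) * x + (1 - z\<^sup>2) * y" and u: "u = (z\<^sup>2 - 1) * x + (z - 1) * y"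
    and P0: "(1 - z) * P0 + (z\<^sup>2 - 1) * Z0 =
      (1 - z) * (c1 - c2 * (z\<^sup>2 * x + z * y)) + w * (c1s - (c2s * (z\<^sup>2 * x + z * y) + c2 * z\<^sup>2))"
      "(1 - z\<^sup>2) * P0 + (z - 1) * Z0 =
      (1 - z\<^sup>2) * (c1 - c2 * (z\<^sup>2 * x + z * y)) + w * (c1t - (c2t * (z\<^sup>2 * x + z * y) + c2 * z))"
    and P3: "(1 - z) * P3 + (z\<^sup>2 - 1) * Z3 =
      (z\<^sup>2 - 1) * (c1 - c2 * (z * x + z\<^sup>2 * y)) + u * (c1s - (c2s * (z * x + z\<^sup>2 * y) + c2 * z))"
      "(1 - z\<^sup>2) * P3 + (z - 1) * Z3 =
      (z - 1) * (c1 - c2 * (z * x + z\<^sup>2 * y)) + u * (c1t - (c2t * (z * x + z\<^sup>2 * y) + c2 * z\<^sup>2))"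
  shows "P0 + Z3 = 2 * c1 + (x * c1s + y * c1t) + (y\<^sup>2 * c2s + x\<^sup>2 * c2t)"
proof -
  have 1: "3 * (z\<^sup>2 - z) * P0 = - (z - 1) * ((1 - z) * P0 + (z\<^sup>2 - 1) * Z0) + (z\<^sup>2 - 1) * ((1 - z\<^sup>2) * P0 + (z - 1) * Z0)"
    using z by algebra
  have 2: "3 * (z\<^sup>2 - z) * Z3 = (1 - z\<^sup>2) * ((1 - z) * P3 + (z\<^sup>2 - 1) * Z3) - (1 - z) * ((1 - z\<^sup>2) * P3 + (z - 1) * Z3)"
    using z by algebra
  have "3 * (z\<^sup>2 - z) * (P0 + Z3) = 3 * (z\<^sup>2 - z) * (2 * c1 + (x * c1s + y * c1t) + (y\<^sup>2 * c2s + x\<^sup>2 * c2t))"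
    unfolding ring_distribs(1)[of "3 * (z\<^sup>2 - z)" P0 Z3] 1 2 P0 P3 w u using z by algebra
  then show ?thesis using z0 by simp
qed

text \<open>
  Here \<open>g11, g20, g02\<close> are the coefficients of degree two of a polynomial \<open>g\<close> in two variables for which
  \<open>g - (z\<^sup>k s + z\<^sup>2\<^sup>k t) h\<close> is divisible by \<open>t - z\<^sup>2\<^sup>k s\<close> for \<open>k = 0, 1, 2\<close>, and \<open>a, b\<close> are the coefficients of \<open>t\<close> and \<open>s\<close>
  in \<open>h\<close>. Each \<open>k\<close> yields one expression for \<open>g11\<close>; their sum is a multiple of \<open>1 + z + z\<^sup>2\<close>.
\<close>

lemma divisibility_coefficients_identity:
  fixes z :: "'a::idom"
  assumes "z\<^sup>2 + z + 1 = 0" "3 \<noteq> (0 :: 'a)"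
    and "g11 = a + b + e10 - e01" "g20 = b - e10" "g02 = a + e01"
    and "g11 = z * a + z\<^sup>2 * b + e10' - z\<^sup>2 * e01'" "g20 = z * b - z\<^sup>2 * e10'" "g02 = z\<^sup>2 * a + e01'"
    and "g11 = z\<^sup>2 * a + z * b + e10'' - z * e01''" "g20 = z\<^sup>2 * b - z * e10''" "g02 = z * a + e01''"
  shows "g11 = 0"
proof -
  have 0: "g11 = 2 * a + 2 * b - g20 - g02"
    using assms(3-5) by algebra
  have 1: "g11 = 2 * z * a + 2 * z\<^sup>2 * b - z * g20 - z\<^sup>2 * g02"
    unfolding assms(6-8) using assms(1) by algebra
  have 2: "g11 = 2 * z\<^sup>2 * a + 2 * z * b - z\<^sup>2 * g20 - z * g02"
    unfolding assms(9-11) using assms(1) by algebra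
  have "3 * g11 = g11 + g11 + g11" by simp
  also have "\<dots> = (2 * a + 2 * b - g20 - g02) + (2 * z * a + 2 * z\<^sup>2 * b - z * g20 - z\<^sup>2 * g02)
      + (2 * z\<^sup>2 * a + 2 * z * b - z\<^sup>2 * g20 - z * g02)"
    using 0 1 2 by presburger
  also have "\<dots> = (z\<^sup>2 + z + 1) * (2 * a + 2 * b - g20 - g02)" by (simp add: algebra_simps)
  also have "\<dots> = 0" using assms(1) by simp
  finally have "3 * g11 = 0" .
  then show ?thesis using assms(2) by simp
qed

lemma witness_identity:
  fixes x y :: "'a::idom"
  shows "- (y * (x ^ 3 - y ^ 3)) * (9 * x ^ 4 - 6 * x) + x * (x ^ 3 - y ^ 3) * (9 * y ^ 4 + 6 * y) =
    12 * (x * y * (x ^ 3 - y ^ 3)) - 9 * (x * y * (x ^ 3 - y ^ 3)\<^sup>2)"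
  by algebra

lemma linear_factors_identity:
  fixes z :: "'a::idom"
  assumes "z\<^sup>2 + z + 1 = 0" "w = (1 - z) * x + (1 - z\<^sup>2) * y" "u = (z\<^sup>2 - 1) * x + (z - 1) * y"
  shows "w = (y - z * x) * (- z\<^sup>2 * (1 - z))" "u = (y - z\<^sup>2 * x) * (z - 1)" "u + w = (y - 1 * x) * (z - z\<^sup>2)"
  using assms by algebra+


section \<open>Coordinates adapted to the arrangement\<close>

definition \<omega> :: complex where
  "\<omega> = Complex (- 1 / 2) (sqrt 3 / 2)"

lemma \<omega>_relation: "\<omega>\<^sup>2 + \<omega> + 1 = 0"
  by (simp add: \<omega>_def complex_eq_iff power2_eq_square)

lemma Const_\<omega>: "(Const \<omega>)\<^sup>2 + Const \<omega> + 1 = 0"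
  using arg_cong[OF \<omega>_relation, of Const] by (simp add: Const_hom)

lemma Const_third: "3 * Const (1 / 3) = 1"
  using Const_hom(2)[of 3 "1 / 3"] by (simp add: Const_numeral)

lemma four_eq_zero: "(4 :: 4) = 0" by simp

lemma sum_4': "(\<Sum>i\<in>UNIV. g (i :: 4)) = g 0 + g 1 + g 2 + g 3"
proof -
  have "(\<Sum>i\<in>UNIV. g (i :: 4)) = g 1 + g 2 + g 3 + g 0" using sum_4[of g] unfolding four_eq_zero .
  then show ?thesis by (simp only: add_ac)
qed

definition vec4 :: "'a \<Rightarrow> 'a \<Rightarrow> 'a \<Rightarrow> 'a \<Rightarrow> 4 \<Rightarrow> 'a" where
  "vec4 a b c d k = (if k = 0 then a else if k = 1 then b else if k = 2 then c else d)"

lemma vec4_simps [simp]: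
  "vec4 a b c d 0 = a" "vec4 a b c d 1 = b" "vec4 a b c d 2 = c" "vec4 a b c d 3 = d"
  by (simp_all add: vec4_def)

definition s :: "4 mpoly" where
  "s = Const (1 / 3) * (X 1 + (Const \<omega>)\<^sup>2 * X 2 + Const \<omega> * X 3)"
definition t :: "4 mpoly" where
  "t = Const (1 / 3) * (X 1 + Const \<omega> * X 2 + (Const \<omega>)\<^sup>2 * X 3)"
definition p :: "4 mpoly" where
  "p = Const (1 / 3) * (Const \<omega> * (X 0 + X 1 + X 2 + X 3) - (Const \<omega>)\<^sup>2 * X 0)"
definition q :: "4 mpoly" where
  "q = Const (1 / 3) * ((Const \<omega>)\<^sup>2 * (X 0 + X 1 + X 2 + X 3) - Const \<omega> * X 0)"

definition ds :: "4 \<Rightarrow> 4 mpoly" where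
  "ds k = Const (vec4 0 1 \<omega> (\<omega>\<^sup>2) k)"
definition dt :: "4 \<Rightarrow> 4 mpoly" where
  "dt k = Const (vec4 0 1 (\<omega>\<^sup>2) \<omega> k)"
definition dp :: "4 \<Rightarrow> 4 mpoly" where
  "dp k = Const (vec4 (1 - \<omega>) (- 1) (- 1) (- 1) k)"
definition dq :: "4 \<Rightarrow> 4 mpoly" where
  "dq k = Const (vec4 (1 - \<omega>\<^sup>2) (- 1) (- 1) (- 1) k)"

text \<open>
  Here \<open>u\<^sub>i = s \<omega>\<^sup>i + t \<omega>\<^sup>-\<^sup>i + m\<close> and \<open>v\<^sub>j = p \<omega>\<^sup>j + q \<omega>\<^sup>-\<^sup>j + m\<close> with the same mean \<open>m\<close>, and \<open>m = - p - q\<close> because \<open>v\<^sub>0 = 0\<close>.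
\<close>

lemma X_in_coordinates:
  "X 0 = (1 - Const \<omega>) * p + (1 - (Const \<omega>)\<^sup>2) * q"
  "X 1 = s + t - p - q"
  "X 2 = Const \<omega> * s + (Const \<omega>)\<^sup>2 * t - p - q"
  "X 3 = (Const \<omega>)\<^sup>2 * s + Const \<omega> * t - p - q"
  by (rule inverse_coordinates_identity[OF Const_\<omega> Const_third s_def t_def p_def q_def])+

lemma vf_power2: "apply_vector_field a (r\<^sup>2) = 2 * r * apply_vector_field a r"
  by (simp add: power2_eq_square vf_mult algebra_simps)

lemma vf_power3: "apply_vector_field a (r ^ 3) = 3 * r\<^sup>2 * apply_vector_field a r"
  by (simp add: power3_eq_cube power2_eq_square vf_mult algebra_simps)

lemma dual_coordinates:
  "apply_vector_field ds s = 1" "apply_vector_field ds t = 0" "apply_vector_field ds p = 0" "apply_vector_field ds q = 0"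
  "apply_vector_field dt s = 0" "apply_vector_field dt t = 1" "apply_vector_field dt p = 0" "apply_vector_field dt q = 0"
  "apply_vector_field dp s = 0" "apply_vector_field dp t = 0" "apply_vector_field dp p = 1" "apply_vector_field dp q = 0"
  "apply_vector_field dq s = 0" "apply_vector_field dq t = 0" "apply_vector_field dq p = 0" "apply_vector_field dq q = 1"
proof -
  note ident = dual_coordinates_identity[OF Const_\<omega> Const_third]
  have coordinates:
    "apply_vector_field a s = Const (1 / 3) * (a 1 + (Const \<omega>)\<^sup>2 * a 2 + Const \<omega> * a 3)"
    "apply_vector_field a t = Const (1 / 3) * (a 1 + Const \<omega> * a 2 + (Const \<omega>)\<^sup>2 * a 3)"
    "apply_vector_field a p = Const (1 / 3) * (Const \<omega> * (a 0 + a 1 + a 2 + a 3) - (Const \<omega>)\<^sup>2 * a 0)"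
    "apply_vector_field a q = Const (1 / 3) * ((Const \<omega>)\<^sup>2 * (a 0 + a 1 + a 2 + a 3) - Const \<omega> * a 0)" for a
    by (simp_all add: s_def t_def p_def q_def vf_simps vf_power2)
  have fields:
    "ds 0 = 0" "ds 1 = 1" "ds 2 = Const \<omega>" "ds 3 = (Const \<omega>)\<^sup>2"
    "dt 0 = 0" "dt 1 = 1" "dt 2 = (Const \<omega>)\<^sup>2" "dt 3 = Const \<omega>"
    "dp 0 = 1 - Const \<omega>" "dp 1 = - 1" "dp 2 = - 1" "dp 3 = - 1"
    "dq 0 = 1 - (Const \<omega>)\<^sup>2" "dq 1 = - 1" "dq 2 = - 1" "dq 3 = - 1"
    by (simp_all add: ds_def dt_def dp_def dq_def Const_hom)
  show "apply_vector_field ds s = 1" "apply_vector_field ds t = 0" "apply_vector_field ds p = 0" "apply_vector_field ds q = 0"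
  "apply_vector_field dt s = 0" "apply_vector_field dt t = 1" "apply_vector_field dt p = 0" "apply_vector_field dt q = 0"
  "apply_vector_field dp s = 0" "apply_vector_field dp t = 0" "apply_vector_field dp p = 1" "apply_vector_field dp q = 0"
  "apply_vector_field dq s = 0" "apply_vector_field dq t = 0" "apply_vector_field dq p = 0" "apply_vector_field dq q = 1"
    unfolding coordinates fields by (rule ident)+
qed

definition bracelet :: "4 mpoly" where
  "bracelet = X 1 * X 2 * X 3 * (X 1 + X 0) * (X 2 + X 0) * (X 3 + X 0) *
     (X 1 + X 2 + X 0) * (X 1 + X 3 + X 0) * (X 2 + X 3 + X 0)"

text \<open>
  After translation by the mean, the monic cubics with roots \<open>v\<close> and \<open>u\<close> differ by the linear polynomial
  \<open>gap1 x - gap0\<close> in the unknown \<open>x\<close>.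
\<close>

definition gap1 :: "4 mpoly" where "gap1 = 3 * (s * t - p * q)"
definition gap0 :: "4 mpoly" where "gap0 = p ^ 3 + q ^ 3 - s ^ 3 - t ^ 3"

text \<open>The resultant of the cubic with roots \<open>u\<close> and of the linear difference.\<close>

lemma bracelet_eq:
  "bracelet = gap0 ^ 3 - 3 * s * t * gap1\<^sup>2 * gap0 - (s ^ 3 + t ^ 3) * gap1 ^ 3"
proof -
  note cubics = cubic_identity[OF Const_\<omega> X_in_coordinates, folded gap0_def gap1_def]
  have "bracelet = (X 1 * (X 1 + X 0) * (X 2 + X 3 + X 0)) *
      (X 2 * (X 2 + X 0) * (X 1 + X 3 + X 0)) * (X 3 * (X 3 + X 0) * (X 1 + X 2 + X 0))"
    by (simp add: bracelet_def mult_ac)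
  also have "\<dots> = gap0 ^ 3 - 3 * s * t * gap1\<^sup>2 * gap0 - (s ^ 3 + t ^ 3) * gap1 ^ 3"
    unfolding cubics by (rule resultant_identity[OF Const_\<omega>])
  finally show ?thesis .
qed

lemmas vf_rules = vf_add vf_diff vf_mult vf_power2 vf_power3 vf_numeral dual_coordinates

abbreviation Fs :: "4 mpoly" where "Fs \<equiv> apply_vector_field ds bracelet"
abbreviation Ft :: "4 mpoly" where "Ft \<equiv> apply_vector_field dt bracelet"
abbreviation Fp :: "4 mpoly" where "Fp \<equiv> apply_vector_field dp bracelet"
abbreviation Fq :: "4 mpoly" where "Fq \<equiv> apply_vector_field dq bracelet"

text \<open>
  Three of the four derivations with cubic coefficients; the fourth is obtained from the first one by
  exchanging \<open>s\<close> and \<open>t\<close>, a symmetry of the resultant.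
\<close>

lemma logarithmic_relations:
  "(6 * t * p * q - t\<^sup>2 * s) * Fs + (s ^ 3 + 2 * p ^ 3 + 2 * q ^ 3) * Ft
     + (3 * s * q\<^sup>2 + 2 * t\<^sup>2 * p) * Fp + (3 * s * p\<^sup>2 + 2 * t\<^sup>2 * q) * Fq = 0"
  "(3 * q * t\<^sup>2 + 2 * p\<^sup>2 * s) * Fs + (3 * q * s\<^sup>2 + 2 * p\<^sup>2 * t) * Ft
     + (q ^ 3 + 2 * s ^ 3 + 2 * t ^ 3) * Fp + (6 * p * s * t - p\<^sup>2 * q) * Fq = 0"
  "(3 * p * t\<^sup>2 + 2 * q\<^sup>2 * s) * Fs + (3 * p * s\<^sup>2 + 2 * q\<^sup>2 * t) * Ft
     + (6 * q * s * t - q\<^sup>2 * p) * Fp + (p ^ 3 + 2 * s ^ 3 + 2 * t ^ 3) * Fq = 0"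
proof -
  have gaps:
    "apply_vector_field ds gap0 = - 3 * s\<^sup>2" "apply_vector_field dt gap0 = - 3 * t\<^sup>2"
    "apply_vector_field dp gap0 = 3 * p\<^sup>2" "apply_vector_field dq gap0 = 3 * q\<^sup>2"
    "apply_vector_field ds gap1 = 3 * t" "apply_vector_field dt gap1 = 3 * s"
    "apply_vector_field dp gap1 = - 3 * q" "apply_vector_field dq gap1 = - 3 * p"
    by (simp_all add: gap0_def gap1_def vf_simps vf_power3 dual_coordinates)
  have vf: "apply_vector_field a bracelet = (3 * gap0\<^sup>2 - 3 * s * t * gap1\<^sup>2) * apply_vector_field a gap0
      - (6 * s * t * gap1 * gap0 + 3 * (s ^ 3 + t ^ 3) * gap1\<^sup>2) * apply_vector_field a gap1
      - 3 * (apply_vector_field a s * t + s * apply_vector_field a t) * gap1\<^sup>2 * gap0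
      - 3 * (s\<^sup>2 * apply_vector_field a s + t\<^sup>2 * apply_vector_field a t) * gap1 ^ 3" for a
    unfolding bracelet_eq
    by (simp add: vf_simps vf_power2 vf_power3) (simp add: algebra_simps power2_eq_square power3_eq_cube)
  have F: "Fs = (3 * gap0\<^sup>2 - 3 * s * t * gap1\<^sup>2) * (- 3 * s\<^sup>2) - (6 * s * t * gap1 * gap0 + 3 * (s^3 + t^3) * gap1\<^sup>2) * (3 * t)
               - 3 * t * gap1\<^sup>2 * gap0 - 3 * s\<^sup>2 * gap1^3"
    "Ft = (3 * gap0\<^sup>2 - 3 * s * t * gap1\<^sup>2) * (- 3 * t\<^sup>2) - (6 * s * t * gap1 * gap0 + 3 * (s^3 + t^3) * gap1\<^sup>2) * (3 * s)
               - 3 * s * gap1\<^sup>2 * gap0 - 3 * t\<^sup>2 * gap1^3"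
    "Fp = (3 * gap0\<^sup>2 - 3 * s * t * gap1\<^sup>2) * (3 * p\<^sup>2) - (6 * s * t * gap1 * gap0 + 3 * (s^3 + t^3) * gap1\<^sup>2) * (- 3 * q)"
    "Fq = (3 * gap0\<^sup>2 - 3 * s * t * gap1\<^sup>2) * (3 * q\<^sup>2) - (6 * s * t * gap1 * gap0 + 3 * (s^3 + t^3) * gap1\<^sup>2) * (- 3 * p)"
    unfolding vf gaps dual_coordinates by simp_all
  show "(6 * t * p * q - t\<^sup>2 * s) * Fs + (s ^ 3 + 2 * p ^ 3 + 2 * q ^ 3) * Ft
     + (3 * s * q\<^sup>2 + 2 * t\<^sup>2 * p) * Fp + (3 * s * p\<^sup>2 + 2 * t\<^sup>2 * q) * Fq = 0"
  "(3 * q * t\<^sup>2 + 2 * p\<^sup>2 * s) * Fs + (3 * q * s\<^sup>2 + 2 * p\<^sup>2 * t) * Ft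
     + (q ^ 3 + 2 * s ^ 3 + 2 * t ^ 3) * Fp + (6 * p * s * t - p\<^sup>2 * q) * Fq = 0"
  "(3 * p * t\<^sup>2 + 2 * q\<^sup>2 * s) * Fs + (3 * p * s\<^sup>2 + 2 * q\<^sup>2 * t) * Ft
     + (6 * q * s * t - q\<^sup>2 * p) * Fp + (p ^ 3 + 2 * s ^ 3 + 2 * t ^ 3) * Fq = 0"
    by (rule logarithmic_identities[OF gap1_def gap0_def F])+
qed

lemma constant_fields_commute:
  assumes "\<And>k. a k = Const (c k)" "\<And>k. b k = Const (d k)"
  shows "apply_vector_field a (apply_vector_field b r) = apply_vector_field b (apply_vector_field a r)"
proof -
  have "apply_vector_field a (apply_vector_field b r) = (\<Sum>i\<in>UNIV. \<Sum>j\<in>UNIV. a i * (b j * pd i (pd j r)))"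
    by (simp add: apply_vector_field_def pd_sum pd_mult assms sum_distrib_left)
  also have "\<dots> = (\<Sum>j\<in>UNIV. \<Sum>i\<in>UNIV. b j * (a i * pd j (pd i r)))"
    by (subst sum.swap) (simp add: pd_commute mult_ac)
  also have "\<dots> = apply_vector_field b (apply_vector_field a r)"
    by (simp add: apply_vector_field_def pd_sum pd_mult assms sum_distrib_left)
  finally show ?thesis .
qed

text \<open>
  The Pfaffian changes sign under the exchange of \<open>s\<close> and \<open>t\<close> and under that of \<open>p\<close> and \<open>q\<close>. No vector field with
  cubic coefficients has the same behaviour under the symmetry group, so there is no first order term.
\<close>

definition pfaffian_op :: "4 weyl" where
  "pfaffian_op = second_order (- (t * (p ^ 3 - q ^ 3))) ds ds + second_order (s * (p ^ 3 - q ^ 3)) dt dt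
      + second_order (- (q * (s ^ 3 - t ^ 3))) dp dp + second_order (p * (s ^ 3 - t ^ 3)) dq dq
      + second_order (2 * t\<^sup>2 * q\<^sup>2 - s * p\<^sup>2 * q - s\<^sup>2 * t * p) ds dp
      + second_order (s * p * q\<^sup>2 + s\<^sup>2 * t * q - 2 * t\<^sup>2 * p\<^sup>2) ds dq
      + second_order (s * t\<^sup>2 * p + t * p\<^sup>2 * q - 2 * s\<^sup>2 * q\<^sup>2) dt dp
      + second_order (2 * s\<^sup>2 * p\<^sup>2 - s * t\<^sup>2 * q - t * p * q\<^sup>2) dt dq"

lemma s_nonzero: "s \<noteq> 0"
  using dual_coordinates(1) by auto

lemma cancel_six_s: "- 6 * s * r = 0 \<Longrightarrow> r = 0" for r :: "4 mpoly"
proof -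
  assume "- 6 * s * r = 0"
  then have "Const (- 1 / 6) * (- 6) * (s * r) = 0" by (simp add: mult.assoc)
  moreover have "Const (- 1 / 6) * (- 6) = (1 :: 4 mpoly)"
    using Const_hom(2)[of "- 1 / 6" "- 6"] by (simp add: Const_numeral Const_hom)
  ultimately have "s * r = 0" by (simp only: mult_1)
  then show ?thesis using s_nonzero by simp
qed

lemma pfaffian_op_symbol_vanishes:
  "- (t * (p ^ 3 - q ^ 3)) * (Fs * Fs) + s * (p ^ 3 - q ^ 3) * (Ft * Ft)
    + - (q * (s ^ 3 - t ^ 3)) * (Fp * Fp) + p * (s ^ 3 - t ^ 3) * (Fq * Fq)
    + (2 * t\<^sup>2 * q\<^sup>2 - s * p\<^sup>2 * q - s\<^sup>2 * t * p) * (Fs * Fp)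
    + (s * p * q\<^sup>2 + s\<^sup>2 * t * q - 2 * t\<^sup>2 * p\<^sup>2) * (Fs * Fq)
    + (s * t\<^sup>2 * p + t * p\<^sup>2 * q - 2 * s\<^sup>2 * q\<^sup>2) * (Ft * Fp)
    + (2 * s\<^sup>2 * p\<^sup>2 - s * t\<^sup>2 * q - t * p * q\<^sup>2) * (Ft * Fq) = 0" (is "?P = 0")
proof (rule cancel_six_s)
  have "- 6 * s * ?P =
      (p\<^sup>2 * Fq - q\<^sup>2 * Fp) * ((6 * t * p * q - t\<^sup>2 * s) * Fs + (s ^ 3 + 2 * p ^ 3 + 2 * q ^ 3) * Ft
        + (3 * s * q\<^sup>2 + 2 * t\<^sup>2 * p) * Fp + (3 * s * p\<^sup>2 + 2 * t\<^sup>2 * q) * Fq)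
      + (2 * q\<^sup>2 * Ft + 2 * t\<^sup>2 * Fq + 3 * t * p * Fs + 3 * s * q * Fp) *
        ((3 * q * t\<^sup>2 + 2 * p\<^sup>2 * s) * Fs + (3 * q * s\<^sup>2 + 2 * p\<^sup>2 * t) * Ft
          + (q ^ 3 + 2 * s ^ 3 + 2 * t ^ 3) * Fp + (6 * p * s * t - p\<^sup>2 * q) * Fq)
      - (2 * p\<^sup>2 * Ft + 2 * t\<^sup>2 * Fp + 3 * t * q * Fs + 3 * s * p * Fq) *
        ((3 * p * t\<^sup>2 + 2 * q\<^sup>2 * s) * Fs + (3 * p * s\<^sup>2 + 2 * q\<^sup>2 * t) * Ft
          + (6 * q * s * t - q\<^sup>2 * p) * Fp + (p ^ 3 + 2 * s ^ 3 + 2 * t ^ 3) * Fq)"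
    by (rule pfaffian_identity)
  also have "\<dots> = 0" by (simp only: logarithmic_relations) simp
  finally show "- 6 * s * ?P = 0" .
qed

text \<open>
  The identity for the symbols again, now with the entries of \<open>A\<close> acting as differential operators on the
  three relations. The first order terms that arise cancel.
\<close>

lemma pfaffian_op_annihilates_poly:
  "- (t * (p ^ 3 - q ^ 3)) * apply_vector_field ds Fs + s * (p ^ 3 - q ^ 3) * apply_vector_field dt Ft
    + - (q * (s ^ 3 - t ^ 3)) * apply_vector_field dp Fp + p * (s ^ 3 - t ^ 3) * apply_vector_field dq Fq
    + (2 * t\<^sup>2 * q\<^sup>2 - s * p\<^sup>2 * q - s\<^sup>2 * t * p) * apply_vector_field ds Fp
    + (s * p * q\<^sup>2 + s\<^sup>2 * t * q - 2 * t\<^sup>2 * p\<^sup>2) * apply_vector_field ds Fq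
    + (s * t\<^sup>2 * p + t * p\<^sup>2 * q - 2 * s\<^sup>2 * q\<^sup>2) * apply_vector_field dt Fp
    + (2 * s\<^sup>2 * p\<^sup>2 - s * t\<^sup>2 * q - t * p * q\<^sup>2) * apply_vector_field dt Fq = 0" (is "?P = 0")
proof (rule cancel_six_s)
  define R2 where "R2 = (6 * t * p * q - t\<^sup>2 * s) * Fs + (s ^ 3 + 2 * p ^ 3 + 2 * q ^ 3) * Ft
     + (3 * s * q\<^sup>2 + 2 * t\<^sup>2 * p) * Fp + (3 * s * p\<^sup>2 + 2 * t\<^sup>2 * q) * Fq"
  define R3 where "R3 = (3 * q * t\<^sup>2 + 2 * p\<^sup>2 * s) * Fs + (3 * q * s\<^sup>2 + 2 * p\<^sup>2 * t) * Ft
     + (q ^ 3 + 2 * s ^ 3 + 2 * t ^ 3) * Fp + (6 * p * s * t - p\<^sup>2 * q) * Fq"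
  define R4 where "R4 = (3 * p * t\<^sup>2 + 2 * q\<^sup>2 * s) * Fs + (3 * p * s\<^sup>2 + 2 * q\<^sup>2 * t) * Ft
     + (6 * q * s * t - q\<^sup>2 * p) * Fp + (p ^ 3 + 2 * s ^ 3 + 2 * t ^ 3) * Fq"
  have zero: "R2 = 0" "R3 = 0" "R4 = 0"
    unfolding R2_def R3_def R4_def by (rule logarithmic_relations)+
  have commute:
    "apply_vector_field dt Fs = apply_vector_field ds Ft" "apply_vector_field dp Fs = apply_vector_field ds Fp"
    "apply_vector_field dq Fs = apply_vector_field ds Fq" "apply_vector_field dp Ft = apply_vector_field dt Fp"
    "apply_vector_field dq Ft = apply_vector_field dt Fq" "apply_vector_field dq Fp = apply_vector_field dp Fq"
    by (rule constant_fields_commute; simp only: ds_def dt_def dp_def dq_def)+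
  have "- 6 * s * ?P =
      p\<^sup>2 * apply_vector_field dq R2 - q\<^sup>2 * apply_vector_field dp R2
      + (2 * q\<^sup>2 * apply_vector_field dt R3 + 2 * t\<^sup>2 * apply_vector_field dq R3
         + 3 * t * p * apply_vector_field ds R3 + 3 * s * q * apply_vector_field dp R3)
      - (2 * p\<^sup>2 * apply_vector_field dt R4 + 2 * t\<^sup>2 * apply_vector_field dp R4
         + 3 * t * q * apply_vector_field ds R4 + 3 * s * p * apply_vector_field dq R4)"
    unfolding R2_def R3_def R4_def by (simp add: vf_rules commute) (simp add: algebra_simps power2_eq_square power3_eq_cube)
  also have "\<dots> = 0" by (simp add: zero)
  finally show "- 6 * s * ?P = 0" .
qed

lemma pfaffian_op_in_ann_fs:
  assumes "bracelet \<noteq> 0"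
  shows "pfaffian_op \<in> ann_fs bracelet"
proof -
  have sum: "[:0, to_fract a1 / to_fract d, to_fract b1 / to_fract d:] + [:0, to_fract a2 / to_fract d, to_fract b2 / to_fract d:] =
    [:0, to_fract (a1 + a2) / to_fract d, to_fract (b1 + b2) / to_fract d:]" for a1 a2 b1 b2 d :: "4 mpoly"
    by (simp add: add_divide_distrib)
  have diff: "c * (g * bracelet - u * v) = c * g * bracelet - c * (u * v)" for c g u v :: "4 mpoly"
    by (simp add: algebra_simps)
  have collect: "(a1 * bracelet - b1) + (a2 * bracelet - b2) = (a1 + a2) * bracelet - (b1 + b2)" for a1 a2 b1 b2 :: "4 mpoly"
    by (simp add: algebra_simps)
  show ?thesis
    unfolding ann_fs_def mem_Collect_eq pfaffian_op_def fs_act_simps(3) fs_act_second_order[OF assms] diff sum collect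
      pfaffian_op_symbol_vanishes pfaffian_op_annihilates_poly
    by simp
qed


section \<open>Restriction to a triple plane\<close>

text \<open>
  The plane \<open>W\<close> with \<open>u\<^sub>i = v\<^sub>i\<close> is given by \<open>s = p\<close> and \<open>t = q\<close>, that is, by \<open>x\<^sub>1 = 0\<close> and \<open>x\<^sub>2 = - x\<^sub>0\<close>. The forms \<open>Wp\<close> and \<open>Zp\<close> are
  the restrictions of \<open>x\<^sub>0\<close> and \<open>x\<^sub>3\<close>.
\<close>

definition Wp :: "2 mpoly" where
  "Wp = (1 - Const \<omega>) * S + (1 - (Const \<omega>)\<^sup>2) * T"
definition Zp :: "2 mpoly" where
  "Zp = ((Const \<omega>)\<^sup>2 - 1) * S + (Const \<omega> - 1) * T"

definition \<rho> :: "4 mpoly \<Rightarrow> 2 mpoly" where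
  "\<rho> = subst (vec4 Wp 0 (- Wp) Zp)"

lemma \<rho>_hom [simp]:
  "\<rho> (a + b) = \<rho> a + \<rho> b" "\<rho> (a - b) = \<rho> a - \<rho> b" "\<rho> (- a) = - \<rho> a" "\<rho> (a * b) = \<rho> a * \<rho> b"
  "\<rho> (a ^ n) = \<rho> a ^ n" "\<rho> (numeral k) = numeral k" "\<rho> 0 = 0" "\<rho> 1 = 1" "\<rho> (Const c) = Const c"
  "\<rho> (X 0) = Wp" "\<rho> (X 1) = 0" "\<rho> (X 2) = - Wp" "\<rho> (X 3) = Zp"
  by (simp_all add: \<rho>_def)

lemma \<rho>_sum: "\<rho> (\<Sum>i\<in>A. g i) = (\<Sum>i\<in>A. \<rho> (g i))"
  by (simp add: \<rho>_def)

lemma \<rho>_coordinates [simp]: "\<rho> s = S" "\<rho> t = T" "\<rho> p = S" "\<rho> q = T"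
  unfolding s_def t_def p_def q_def \<rho>_hom
  by (rule restricted_coordinates_identity[OF Const_\<omega> Const_third Wp_def Zp_def])+

text \<open>
  A polynomial that restricts to the exponent of the weight on \<open>W\<close>. It is chosen independent of \<open>p\<close> and \<open>q\<close>, so that
  transposition changes only the sign of \<open>\<partial>\<^sub>p\<close> and \<open>\<partial>\<^sub>q\<close>.
\<close>

definition twist :: "4 mpoly" where "twist = s ^ 3 - t ^ 3"


lemma \<rho>_transpose_pfaffian_op:
  "\<rho> (weyl_transpose twist pfaffian_op 1) = 12 * (S * T * (S ^ 3 - T ^ 3)) - 9 * (S * T * (S ^ 3 - T ^ 3)\<^sup>2)"
proof -
  have const: "weyl_transpose twist (vector_field ds) r = 3 * s\<^sup>2 * r - apply_vector_field ds r"
    "weyl_transpose twist (vector_field dt) r = - 3 * t\<^sup>2 * r - apply_vector_field dt r"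
    "weyl_transpose twist (vector_field dp) r = - apply_vector_field dp r"
    "weyl_transpose twist (vector_field dq) r = - apply_vector_field dq r" for r
    using transpose_constant_field[OF ds_def, where h = twist and q = r] transpose_constant_field[OF dt_def, where h = twist and q = r]
      transpose_constant_field[OF dp_def, where h = twist and q = r] transpose_constant_field[OF dq_def, where h = twist and q = r]
    by (simp_all add: twist_def vf_simps vf_power3 dual_coordinates)
  have second: "weyl_transpose twist (second_order c a b) 1 =
      weyl_transpose twist (vector_field b) (weyl_transpose twist (vector_field a) c)" for c a b
    by (simp add: second_order_def transpose_simps)
  note vf = vf_simps vf_power2 vf_power3 vf_numeral dual_coordinates
  have pure:
    "weyl_transpose twist (second_order c ds ds) 1 = c * (9 * s ^ 4 - 6 * s)" if "apply_vector_field ds c = 0" for c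
    unfolding second const that
    by (simp add: vf that) (simp add: algebra_simps power2_eq_square eval_nat_numeral)
  have pure':
    "weyl_transpose twist (second_order c dt dt) 1 = c * (9 * t ^ 4 + 6 * t)" if "apply_vector_field dt c = 0" for c
    unfolding second const that
    by (simp add: vf that) (simp add: algebra_simps power2_eq_square eval_nat_numeral)
  have normal: "weyl_transpose twist (second_order c dp dp) 1 = 0" if "apply_vector_field dp c = 0" for c
    unfolding second const that by simp
  have normal': "weyl_transpose twist (second_order c dq dq) 1 = 0" if "apply_vector_field dq c = 0" for c
    unfolding second const that by simp
  have mixed:
    "weyl_transpose twist (second_order c ds dp) 1 = apply_vector_field dp (apply_vector_field ds c) - 3 * s\<^sup>2 * apply_vector_field dp c"
    "weyl_transpose twist (second_order c ds dq) 1 = apply_vector_field dq (apply_vector_field ds c) - 3 * s\<^sup>2 * apply_vector_field dq c"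
    "weyl_transpose twist (second_order c dt dp) 1 = apply_vector_field dp (apply_vector_field dt c) + 3 * t\<^sup>2 * apply_vector_field dp c"
    "weyl_transpose twist (second_order c dt dq) 1 = apply_vector_field dq (apply_vector_field dt c) + 3 * t\<^sup>2 * apply_vector_field dq c" for c
    unfolding second const by (simp_all add: vf)
  have zero: "apply_vector_field ds (- (t * (p ^ 3 - q ^ 3))) = 0" "apply_vector_field dt (s * (p ^ 3 - q ^ 3)) = 0"
    "apply_vector_field dp (- (q * (s ^ 3 - t ^ 3))) = 0" "apply_vector_field dq (p * (s ^ 3 - t ^ 3)) = 0"
    by (simp_all add: vf)
  \<comment> \<open>The mixed terms come in pairs that are exchanged by \<open>p \<leftrightarrow> q\<close> up to sign.\<close>
  have cancel:
    "weyl_transpose twist (second_order (2 * t\<^sup>2 * q\<^sup>2 - s * p\<^sup>2 * q - s\<^sup>2 * t * p) ds dp) 1 +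
     weyl_transpose twist (second_order (s * p * q\<^sup>2 + s\<^sup>2 * t * q - 2 * t\<^sup>2 * p\<^sup>2) ds dq) 1 = 0"
    "weyl_transpose twist (second_order (s * t\<^sup>2 * p + t * p\<^sup>2 * q - 2 * s\<^sup>2 * q\<^sup>2) dt dp) 1 +
     weyl_transpose twist (second_order (2 * s\<^sup>2 * p\<^sup>2 - s * t\<^sup>2 * q - t * p * q\<^sup>2) dt dq) 1 = 0"
    unfolding mixed by (simp_all add: vf algebra_simps)
  have "weyl_transpose twist pfaffian_op 1 = - (t * (p ^ 3 - q ^ 3)) * (9 * s ^ 4 - 6 * s) + s * (p ^ 3 - q ^ 3) * (9 * t ^ 4 + 6 * t)"
    unfolding pfaffian_op_def transpose_simps(3) pure[OF zero(1)] pure'[OF zero(2)] normal[OF zero(3)] normal'[OF zero(4)]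
    using cancel by (simp add: add.assoc)
  then have "\<rho> (weyl_transpose twist pfaffian_op 1) =
      - (T * (S ^ 3 - T ^ 3)) * (9 * S ^ 4 - 6 * S) + S * (S ^ 3 - T ^ 3) * (9 * T ^ 4 + 6 * T)"
    by simp
  also have "\<dots> = 12 * (S * T * (S ^ 3 - T ^ 3)) - 9 * (S * T * (S ^ 3 - T ^ 3)\<^sup>2)"
    by (rule witness_identity)
  finally show ?thesis .
qed

text \<open>The pair \<open>(i, j)\<close> stands for the form \<open>u\<^sub>i - v\<^sub>j\<close>.\<close>

definition form_coeff :: "nat \<times> nat \<Rightarrow> 4 \<Rightarrow> complex" where
  "form_coeff = (\<lambda>(i, j) k.
     (if i = 0 then vec4 0 1 0 0 else if i = 1 then vec4 0 0 1 0 else vec4 0 0 0 1) k -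
     (if j = 0 then vec4 0 0 0 0 else if j = 1 then vec4 (- 1) 0 0 0 else vec4 1 1 1 1) k)"

definition form :: "nat \<times> nat \<Rightarrow> 4 mpoly" where
  "form x = linear_form (form_coeff x)"

definition cells :: "(nat \<times> nat) set" where
  "cells = {0, 1, 2} \<times> {0, 1, 2}"

lemma forms:
  "form (0, 0) = X 1" "form (0, 1) = X 1 + X 0" "form (0, 2) = - (X 2 + X 3 + X 0)"
  "form (1, 0) = X 2" "form (1, 1) = X 2 + X 0" "form (1, 2) = - (X 1 + X 3 + X 0)"
  "form (2, 0) = X 3" "form (2, 1) = X 3 + X 0" "form (2, 2) = - (X 1 + X 2 + X 0)"
  unfolding form_def linear_form_def sum_4' form_coeff_def by (simp_all add: Const_hom)

lemma cells_eq: "cells = {(0,0), (0,1), (0,2), (1,0), (1,1), (1,2), (2,0), (2,1), (2,2)}"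
  by (auto simp: cells_def)

lemma prod_forms: "(\<Prod>x\<in>cells. form x) = - bracelet"
proof -
  have "(\<Prod>x\<in>cells. form x) = form (0, 0) * form (0, 1) * form (0, 2) * form (1, 0) * form (1, 1)
      * form (1, 2) * form (2, 0) * form (2, 1) * form (2, 2)"
    unfolding cells_eq by (simp add: mult_ac)
  then show ?thesis unfolding forms bracelet_def by (simp add: mult_ac del: minus_add_distrib)
qed

text \<open>
  Points that lie on exactly one of the nine hyperplanes. They show that the hyperplanes are distinct and
  that no form divides another one.
\<close>

definition generic_point :: "nat \<times> nat \<Rightarrow> 4 \<Rightarrow> complex" where
  "generic_point = (\<lambda>(i, j).
     if i = 0 then (if j = 0 then vec4 (-1) 0 (-1) (-1) else if j = 1 then vec4 (-1) 1 (-1) (-1) else vec4 0 (-2) (-1) 1)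
     else if i = 1 then (if j = 0 then vec4 (-1) (-1) 0 (-1) else if j = 1 then vec4 (-1) (-1) 1 (-1) else vec4 0 (-1) (-2) 1)
     else (if j = 0 then vec4 (-1) (-1) (-1) 0 else if j = 1 then vec4 (-1) (-1) (-1) 1 else vec4 0 (-1) 1 (-2)))"

lemma generic_point:
  assumes "x \<in> cells" "y \<in> cells"
  shows "(\<Sum>k\<in>UNIV. form_coeff y k * generic_point x k) = 0 \<longleftrightarrow> x = y"
  using assms unfolding cells_eq sum_4' form_coeff_def generic_point_def
  by (elim insertE emptyE; simp)

lemma prime_form: "x \<in> cells \<Longrightarrow> prime_elem (form x)"
  unfolding form_def
proof (rule prime_linear_form)
  assume "x \<in> cells"
  moreover define y :: "nat \<times> nat" where "y = (if x = (0, 0) then (0, 1) else (0, 0))"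
  ultimately have "x \<in> cells" "y \<in> cells" "y \<noteq> x" by (auto simp: cells_def)
  then show "form_coeff x \<noteq> (\<lambda>_. 0)"
    using generic_point[OF \<open>y \<in> cells\<close> \<open>x \<in> cells\<close>] by auto
qed

lemma form_not_dvd: "x \<in> cells \<Longrightarrow> y \<in> cells \<Longrightarrow> x \<noteq> y \<Longrightarrow> \<not> form x dvd form y"
  unfolding form_def
  by (rule linear_form_not_dvd[where c = "generic_point x"]) (simp_all add: generic_point)

text \<open>
  Three of the forms that sum to zero meet in a common plane. Eliminating one of them shows that the
  logarithmic derivatives agree on this plane.
\<close>

lemma congruence_along_triple:
  fixes a :: "4 \<Rightarrow> 4 mpoly"
  assumes "x \<in> cells" "y \<in> cells" "x \<noteq> y" "form x + form y + form z = 0"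
    and b: "apply_vector_field a (form x) = form x * b x" "apply_vector_field a (form y) = form y * b y"
      "apply_vector_field a (form z) = form z * b z"
  shows "form x dvd b y - b z"
proof -
  have z: "form z = - form x - form y" using assms(4) by (simp add: eq_neg_iff_add_eq_0 algebra_simps)
  have "form x * b x + form y * b y + form z * b z = apply_vector_field a (form x + form y + form z)"
    by (simp add: vf_add b)
  also have "\<dots> = 0" by (simp add: assms(4))
  finally have "form y * (b y - b z) = form x * (b z - b x)"
    unfolding z by (simp add: algebra_simps)
  then have "form x dvd form y * (b y - b z)" by simp
  then show ?thesis
    using prime_elem_dvd_mult_iff[OF prime_form] form_not_dvd assms(1-3) by blast
qed

lemma restricted_chain_rule:
  "pd 0 (\<rho> r) = (1 - Const \<omega>) * (\<rho> (pd 0 r) - \<rho> (pd 2 r)) + ((Const \<omega>)\<^sup>2 - 1) * \<rho> (pd 3 r)"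
  "pd 1 (\<rho> r) = (1 - (Const \<omega>)\<^sup>2) * (\<rho> (pd 0 r) - \<rho> (pd 2 r)) + (Const \<omega> - 1) * \<rho> (pd 3 r)"
proof -
  have power: "(Const \<omega>)\<^sup>2 = (Const (\<omega>\<^sup>2) :: 2 mpoly)" by (simp add: Const_hom)
  have d: "pd 0 Wp = 1 - Const \<omega>" "pd 1 Wp = 1 - (Const \<omega>)\<^sup>2"
    "pd 0 Zp = (Const \<omega>)\<^sup>2 - 1" "pd 1 Zp = Const \<omega> - 1"
    unfolding Wp_def Zp_def power by (simp_all add: pd_add pd_diff pd_mult pd_X)
  have chain: "pd j (\<rho> r) = \<rho> (pd 0 r) * pd j Wp + \<rho> (pd 1 r) * pd j 0 + \<rho> (pd 2 r) * pd j (- Wp) + \<rho> (pd 3 r) * pd j Zp" for j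
    by (simp only: \<rho>_def pd_subst sum_4' vec4_simps)
  show
    "pd 0 (\<rho> r) = (1 - Const \<omega>) * (\<rho> (pd 0 r) - \<rho> (pd 2 r)) + ((Const \<omega>)\<^sup>2 - 1) * \<rho> (pd 3 r)"
    "pd 1 (\<rho> r) = (1 - (Const \<omega>)\<^sup>2) * (\<rho> (pd 0 r) - \<rho> (pd 2 r)) + (Const \<omega> - 1) * \<rho> (pd 3 r)"
    unfolding chain d pd_uminus pd_zero by (simp_all add: algebra_simps)
qed

lemma coef_divisibility:
  assumes "g = c * (Const \<alpha> * S + Const \<beta> * T) + (T - Const \<gamma> * S) * e"
  shows "coef 1 1 g = \<alpha> * coef 0 1 c + \<beta> * coef 1 0 c + coef 1 0 e - \<gamma> * coef 0 1 e"
    "coef 2 0 g = \<alpha> * coef 1 0 c - \<gamma> * coef 1 0 e" "coef 0 2 g = \<beta> * coef 0 1 c + coef 0 1 e"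
proof -
  have g: "g = Const \<alpha> * (S * c) + (Const \<beta> * (T * c) + (T * e + Const (- \<gamma>) * (S * e)))"
    unfolding assms by (simp add: algebra_simps Const_hom)
  have "coef (Suc 0) (Suc 0) g = \<alpha> * coef 0 (Suc 0) c + (\<beta> * coef (Suc 0) 0 c + (coef (Suc 0) 0 e + - \<gamma> * coef 0 (Suc 0) e))"
    unfolding g by (simp only: coef_add coef_mult)
  moreover have "coef (Suc (Suc 0)) 0 g = \<alpha> * coef (Suc 0) 0 c + (\<beta> * 0 + (0 + - \<gamma> * coef (Suc 0) 0 e))"
    unfolding g by (simp only: coef_add coef_mult)
  moreover have "coef 0 (Suc (Suc 0)) g = \<alpha> * 0 + (\<beta> * coef 0 (Suc 0) c + (coef 0 (Suc 0) e + - \<gamma> * 0))"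
    unfolding g by (simp only: coef_add coef_mult)
  ultimately show "coef 1 1 g = \<alpha> * coef 0 1 c + \<beta> * coef 1 0 c + coef 1 0 e - \<gamma> * coef 0 1 e"
    "coef 2 0 g = \<alpha> * coef 1 0 c - \<gamma> * coef 1 0 e" "coef 0 2 g = \<beta> * coef 0 1 c + coef 0 1 e"
    by (simp_all add: numeral_2_eq_2)
qed


lemma three_neq_0: "(3 :: 'v::linorder mpoly) \<noteq> 0" "3 * ((Const \<omega>)\<^sup>2 - Const \<omega>) \<noteq> (0 :: 'v mpoly)"
proof -
  have *: "Const c \<noteq> (0 :: 'v mpoly)" if "c \<noteq> 0" for c
    using that Const_inject[of c 0] by simp
  show "(3 :: 'v mpoly) \<noteq> 0" using *[of 3] by (simp add: Const_numeral)
  have "3 * (\<omega>\<^sup>2 - \<omega>) \<noteq> 0"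
    by (simp add: \<omega>_def complex_eq_iff power2_eq_square)
  then show "3 * ((Const \<omega>)\<^sup>2 - Const \<omega>) \<noteq> (0 :: 'v mpoly)"
    using *[of "3 * (\<omega>\<^sup>2 - \<omega>)"] by (simp add: Const_hom Const_numeral)
qed

lemma Wp_Zp: "Wp \<noteq> 0" "Zp \<noteq> 0" "Zp + Wp \<noteq> 0" "prime_elem Zp" "\<not> Zp dvd Wp"
proof -
  define cW where "cW = (\<lambda>k :: 2. if k = 0 then 1 - \<omega> else 1 - \<omega>\<^sup>2)"
  define cZ where "cZ = (\<lambda>k :: 2. if k = 0 then \<omega>\<^sup>2 - 1 else \<omega> - 1)"
  have W: "Wp = linear_form cW" and Z: "Zp = linear_form cZ"
    unfolding linear_form_def sum_2' Wp_def Zp_def cW_def cZ_def by (simp_all add: Const_hom)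
  have nz: "\<omega> \<noteq> 1" "\<omega> \<noteq> 0" by (simp_all add: \<omega>_def complex_eq_iff)
  have "cZ 1 \<noteq> 0" using nz by (simp add: cZ_def)
  then show prime: "prime_elem Zp" unfolding Z by (intro prime_linear_form) auto
  have \<omega>2: "\<omega>\<^sup>2 = - 1 - \<omega>" using \<omega>_relation by (simp add: eq_diff_eq eq_neg_iff_add_eq_0 add_ac)
  have "(\<Sum>k\<in>UNIV. cW k * (if k = 0 then 1 else \<omega>\<^sup>2)) = - 3 * \<omega>"
    unfolding sum_2' cW_def \<omega>2 by (simp add: algebra_simps \<omega>2 flip: power2_eq_square)
  then have "(\<Sum>k\<in>UNIV. cW k * (if k = 0 then 1 else \<omega>\<^sup>2)) \<noteq> 0" using nz by simp
  moreover have "(\<Sum>k\<in>UNIV. cZ k * (if k = 0 then 1 else \<omega>\<^sup>2)) = 0"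
    unfolding sum_2' cZ_def \<omega>2 by (simp add: algebra_simps \<omega>2 flip: power2_eq_square)
  ultimately show not_dvd: "\<not> Zp dvd Wp"
    unfolding W Z by (intro linear_form_not_dvd[where c = "\<lambda>k. if k = 0 then 1 else \<omega>\<^sup>2"])
  show "Zp \<noteq> 0" using prime by (simp add: prime_elem_def)
  show "Wp \<noteq> 0" using not_dvd by auto
  show "Zp + Wp \<noteq> 0"
  proof
    assume "Zp + Wp = 0"
    then have "Wp = Zp * (- 1)" by (simp add: eq_neg_iff_add_eq_0 add.commute)
    then show False using not_dvd by (metis dvd_triv_left)
  qed
qed

text \<open>
  Let \<open>b (i, j)\<close> be the logarithmic derivative along \<open>u\<^sub>i - v\<^sub>j\<close>. On \<open>W\<close> the three \<open>b (i, i)\<close> have a common value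
  \<open>\<tau>\<close>, while \<open>b (i, j) = b (j, i)\<close> is the logarithmic derivative along \<open>u\<^sub>i - u\<^sub>j\<close>. Interpolation gives
  \<open>b (i, j) = c\<^sub>1 - c\<^sub>2 u\<^sub>k\<close> for the third index \<open>k\<close> (with \<open>u\<close> translated to mean zero), and the vanishing of the
  sum of all logarithmic derivatives gives \<open>\<tau> = - 2 c\<^sub>1\<close>. The transposition of \<open>i\<close> and \<open>j\<close> defines another plane
  in three hyperplanes, which meets \<open>W\<close> in the line \<open>u\<^sub>i = u\<^sub>j\<close>; there \<open>b (i, j)\<close> equals \<open>b (k, k) = \<tau>\<close>.
  So \<open>u\<^sub>i - u\<^sub>j\<close> divides \<open>3 c\<^sub>1 - c\<^sub>2 u\<^sub>k\<close>, for three choices of \<open>k\<close>. These divisibilities remove the coefficient of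
  \<open>s t\<close> from \<open>c\<^sub>1\<close>.
\<close>

lemma restricted_field:
  assumes "apply_vector_field a bracelet = 0"
  obtains c1 c2 where
    "\<rho> (a 1) = 0" "\<rho> (a 2) = - \<rho> (a 0)"
    "\<rho> (a 0) = Wp * (c1 - c2 * ((Const \<omega>)\<^sup>2 * S + Const \<omega> * T))"
    "\<rho> (a 3) = Zp * (c1 - c2 * (Const \<omega> * S + (Const \<omega>)\<^sup>2 * T))"
    "\<rho> (pd 1 (a 1)) = - 2 * c1" "\<rho> (pd 2 (a 2)) = - 2 * c1 - \<rho> (pd 2 (a 0))"
    "coef 1 1 c1 = 0"
proof -
  have "apply_vector_field a (\<Prod>x\<in>cells. form x) = 0"
    using assms by (simp add: prod_forms vf_uminus)
  moreover have "finite cells" by (simp add: cells_def)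
  ultimately obtain b where b: "\<And>x. x \<in> cells \<Longrightarrow> apply_vector_field a (form x) = form x * b x"
    and sum_b: "(\<Sum>x\<in>cells. b x) = 0"
    using logarithmic_derivatives[of cells form a] prime_form form_not_dvd by metis
  have cells: "(0,0) \<in> cells" "(0,1) \<in> cells" "(0,2) \<in> cells" "(1,0) \<in> cells" "(1,1) \<in> cells"
    "(1,2) \<in> cells" "(2,0) \<in> cells" "(2,1) \<in> cells" "(2,2) \<in> cells"
    by (simp_all add: cells_def)
  note field = cells[THEN b, unfolded forms vf_add vf_uminus vf_X]
  have congruence: "form x dvd b y - b z"
    if "x \<in> cells" "y \<in> cells" "z \<in> cells" "x \<noteq> y" "form x + form y + form z = 0" for x y z
    using congruence_along_triple[of x y z a b] that b by blast
  have "form (0, 0) dvd b (1, 1) - b (2, 2)" "form (1, 1) dvd b (0, 0) - b (2, 2)"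
    and dvd: "form (1, 0) dvd b (0, 1) - b (2, 2)" "form (2, 0) dvd b (0, 2) - b (1, 1)"
    "form (2, 1) dvd b (1, 2) - b (0, 0)"
    by (intro congruence cells; simp add: forms forms[unfolded One_nat_def])+
  then have "\<rho> (form (0, 0)) dvd \<rho> (b (1, 1) - b (2, 2))" "\<rho> (form (1, 1)) dvd \<rho> (b (0, 0) - b (2, 2))"
    by (simp_all only: \<rho>_def subst_dvd)
  then have b11: "\<rho> (b (1, 1)) = \<rho> (b (2, 2))" and b00: "\<rho> (b (0, 0)) = \<rho> (b (2, 2))"
    unfolding forms by simp_all
  have a1: "\<rho> (a 1) = 0" using arg_cong[OF field(1), of \<rho>] by simp
  have a0: "\<rho> (a 0) = Wp * \<rho> (b (0, 1))" using arg_cong[OF field(2), of \<rho>] a1 by simp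
  have a2: "\<rho> (a 2) = - \<rho> (a 0)"
    using arg_cong[OF field(5), of \<rho>] by (simp add: eq_neg_iff_add_eq_0)
  have a3: "\<rho> (a 3) = Zp * \<rho> (b (0, 2))"
    using arg_cong[OF field(3), of \<rho>] a2 by (simp add: algebra_simps)
  have b10: "\<rho> (b (1, 0)) = \<rho> (b (0, 1))"
    using arg_cong[OF field(4), of \<rho>] a2 a0 Wp_Zp by simp
  have b20: "\<rho> (b (2, 0)) = \<rho> (b (0, 2))"
    using arg_cong[OF field(7), of \<rho>] a3 Wp_Zp by simp
  have b12: "(Zp + Wp) * \<rho> (b (1, 2)) = Zp * \<rho> (b (0, 2)) + Wp * \<rho> (b (0, 1))"
    using arg_cong[OF field(6), of \<rho>] a0 a1 a3 by (simp add: algebra_simps)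
  have "(Zp + Wp) * \<rho> (b (2, 1)) = (Zp + Wp) * \<rho> (b (1, 2))"
    unfolding b12 using arg_cong[OF field(8), of \<rho>] a0 a3 by simp
  then have b21: "\<rho> (b (2, 1)) = \<rho> (b (1, 2))" using mult_left_cancel[OF Wp_Zp(3)] by blast
  \<comment> \<open>Interpolation: \<open>e\<close> is, up to sign, the divided difference of the values on \<open>W\<close>.\<close>
  have rel: "Wp * (\<rho> (b (0, 1)) - \<rho> (b (1, 2))) = Zp * (\<rho> (b (1, 2)) - \<rho> (b (0, 2)))"
    using b12 by (simp add: algebra_simps)
  then have "Zp dvd Wp * (\<rho> (b (0, 1)) - \<rho> (b (1, 2)))" by simp
  then have "Zp dvd \<rho> (b (0, 1)) - \<rho> (b (1, 2))"
    using prime_elem_dvd_mult_iff[OF Wp_Zp(4)] Wp_Zp(5) by blast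
  then obtain e where e: "\<rho> (b (0, 1)) - \<rho> (b (1, 2)) = Zp * e" by (elim dvdE)
  have "Zp * (Wp * e) = Zp * (\<rho> (b (1, 2)) - \<rho> (b (0, 2)))"
    using rel unfolding e by (simp add: mult_ac)
  then have e': "\<rho> (b (1, 2)) - \<rho> (b (0, 2)) = Wp * e" using Wp_Zp(2) by simp
  define c2 where "c2 = - e"
  define c1 where "c1 = \<rho> (b (1, 2)) + c2 * (S + T)"
  have \<beta>: "\<rho> (b (1, 2)) = c1 - c2 * (S + T)"
    "\<rho> (b (0, 1)) = c1 - c2 * ((Const \<omega>)\<^sup>2 * S + Const \<omega> * T)"
    "\<rho> (b (0, 2)) = c1 - c2 * (Const \<omega> * S + (Const \<omega>)\<^sup>2 * T)"
  proof -
    show 0: "\<rho> (b (1, 2)) = c1 - c2 * (S + T)" by (simp add: c1_def)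
    have "\<rho> (b (0, 1)) = \<rho> (b (1, 2)) - c2 * Zp" using e by (simp add: c2_def algebra_simps)
    then show "\<rho> (b (0, 1)) = c1 - c2 * ((Const \<omega>)\<^sup>2 * S + Const \<omega> * T)"
      unfolding 0 Zp_def by (simp add: algebra_simps)
    have "\<rho> (b (0, 2)) = \<rho> (b (1, 2)) + c2 * Wp" using e' by (simp add: c2_def algebra_simps)
    then show "\<rho> (b (0, 2)) = c1 - c2 * (Const \<omega> * S + (Const \<omega>)\<^sup>2 * T)"
      unfolding 0 Wp_def by (simp add: algebra_simps)
  qed
  have \<tau>: "\<rho> (b (2, 2)) = - 2 * c1"
  proof -
    have "0 = \<rho> (\<Sum>x\<in>cells. b x)" by (simp add: sum_b)
    also have "\<dots> = 3 * \<rho> (b (2, 2)) + 2 * (\<rho> (b (1, 2)) + \<rho> (b (0, 1)) + \<rho> (b (0, 2)))"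
      unfolding cells_eq \<rho>_sum by (simp add: b11[unfolded One_nat_def] b00 b10[unfolded One_nat_def] b20 b21[unfolded One_nat_def])
    also have "\<dots> = 3 * (\<rho> (b (2, 2)) + 2 * c1) - 2 * (c2 * (((Const \<omega>)\<^sup>2 + Const \<omega> + 1) * (S + T)))"
      unfolding \<beta> by (simp add: algebra_simps)
    also have "\<dots> = 3 * (\<rho> (b (2, 2)) + 2 * c1)" by (simp add: Const_\<omega>)
    finally have "3 * (\<rho> (b (2, 2)) + 2 * c1) = 0" by (rule HOL.sym)
    then have "\<rho> (b (2, 2)) + 2 * c1 = 0" using three_neq_0(1) mult_eq_0_iff by blast
    then show ?thesis by (simp add: eq_neg_iff_add_eq_0)
  qed
  have coef0: "coef 1 1 c1 = 0"
  proof -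
    note factors = linear_factors_identity[OF Const_\<omega> Wp_def Zp_def]
    have "\<rho> (form (1, 0)) dvd \<rho> (b (0, 1) - b (2, 2))" "\<rho> (form (2, 0)) dvd \<rho> (b (0, 2) - b (1, 1))"
      "\<rho> (form (2, 1)) dvd \<rho> (b (1, 2) - b (0, 0))"
      using dvd by (simp_all only: \<rho>_def subst_dvd)
    then have "Wp dvd 3 * c1 - c2 * ((Const \<omega>)\<^sup>2 * S + Const \<omega> * T)"
      "Zp dvd 3 * c1 - c2 * (Const \<omega> * S + (Const \<omega>)\<^sup>2 * T)" "Zp + Wp dvd 3 * c1 - c2 * (S + T)"
      unfolding forms \<rho>_hom b00 b11 \<tau> \<beta> by (simp_all add: algebra_simps)
    moreover have "T - Const \<omega> * S dvd Wp" "T - (Const \<omega>)\<^sup>2 * S dvd Zp" "T - 1 * S dvd Zp + Wp"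
      using factors by (metis dvd_triv_left)+
    ultimately have "T - Const \<omega> * S dvd 3 * c1 - c2 * ((Const \<omega>)\<^sup>2 * S + Const \<omega> * T)"
      "T - (Const \<omega>)\<^sup>2 * S dvd 3 * c1 - c2 * (Const \<omega> * S + (Const \<omega>)\<^sup>2 * T)"
      "T - 1 * S dvd 3 * c1 - c2 * (S + T)"
      by (blast intro: dvd_trans)+
    then obtain e0 e1 e2 where
      "3 * c1 - c2 * ((Const \<omega>)\<^sup>2 * S + Const \<omega> * T) = (T - Const \<omega> * S) * e2"
      "3 * c1 - c2 * (Const \<omega> * S + (Const \<omega>)\<^sup>2 * T) = (T - (Const \<omega>)\<^sup>2 * S) * e1"
      "3 * c1 - c2 * (S + T) = (T - 1 * S) * e0"
      unfolding dvd_def by blast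
    then have
      "3 * c1 = c2 * (Const 1 * S + Const 1 * T) + (T - Const 1 * S) * e0"
      "3 * c1 = c2 * (Const \<omega> * S + Const (\<omega>\<^sup>2) * T) + (T - Const (\<omega>\<^sup>2) * S) * e1"
      "3 * c1 = c2 * (Const (\<omega>\<^sup>2) * S + Const \<omega> * T) + (T - Const \<omega> * S) * e2"
      by (simp_all add: Const_hom algebra_simps)
    from this[THEN coef_divisibility(1)] this[THEN coef_divisibility(2)] this[THEN coef_divisibility(3)]
    have "coef 1 1 (3 * c1) = 0"
      by (intro divisibility_coefficients_identity[OF \<omega>_relation,
            of "coef 1 1 (3 * c1)" "coef 0 1 c2" "coef 1 0 c2" "coef 1 0 e0" "coef 0 1 e0" "coef 2 0 (3 * c1)"
            "coef 0 2 (3 * c1)" "coef 1 0 e1" "coef 0 1 e1" "coef 1 0 e2" "coef 0 1 e2"]) simp_all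
    moreover have "3 * c1 = Const 3 * c1" by (simp add: Const_numeral)
    ultimately show ?thesis using coef_mult(1)[of 1 1 3 c1] by simp
  qed
  have p1: "\<rho> (pd 1 (a 1)) = - 2 * c1"
    unfolding field(1) by (simp add: pd_mult pd_X b00 \<tau>)
  have "\<rho> (pd 2 (a 2 + a 0)) = - 2 * c1"
    unfolding field(5) by (simp add: pd_mult pd_add pd_X b11[unfolded One_nat_def] \<tau>)
  then have p2: "\<rho> (pd 2 (a 2)) = - 2 * c1 - \<rho> (pd 2 (a 0))" by (simp add: pd_add eq_diff_eq)
  show ?thesis
    using that[of c1 c2] a1 a2 a0 a3 p1 p2 coef0 unfolding \<beta> by blast
qed

text \<open>
  By the previous lemma the transpose of the derivation, applied to \<open>1\<close>, restricts on \<open>W\<close> to the transpose of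
  \<open>c\<^sub>1 (E + 4) + c\<^sub>2 (t\<^sup>2 \<partial>\<^sub>s + s\<^sup>2 \<partial>\<^sub>t)\<close>: the two directions normal to \<open>W\<close> contribute \<open>- 2 \<tau> = 4 c\<^sub>1\<close>. The second term is
  annihilated by invariance, and the first one by homogeneity up to the coefficient of \<open>s t\<close> in \<open>c\<^sub>1\<close>.
\<close>

lemma integral_of_divergence:
  assumes "apply_vector_field a bracelet = 0"
  shows "integral2 (\<rho> (\<Sum>i\<in>UNIV. pd i twist * a i - pd i (a i))) = 0"
proof -
  obtain c1 c2 where a1: "\<rho> (a 1) = 0" and a2: "\<rho> (a 2) = - \<rho> (a 0)"
    and a0: "\<rho> (a 0) = Wp * (c1 - c2 * ((Const \<omega>)\<^sup>2 * S + Const \<omega> * T))"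
    and a3: "\<rho> (a 3) = Zp * (c1 - c2 * (Const \<omega> * S + (Const \<omega>)\<^sup>2 * T))"
    and p1: "\<rho> (pd 1 (a 1)) = - 2 * c1" and p2: "\<rho> (pd 2 (a 2)) = - 2 * c1 - \<rho> (pd 2 (a 0))"
    and coef: "coef 1 1 c1 = 0"
    using restricted_field[OF assms] by metis
  have power: "(Const \<omega>)\<^sup>2 = (Const (\<omega>\<^sup>2) :: 2 mpoly)" by (simp add: Const_hom)
  have pdW: "pd 0 Wp = 1 - Const \<omega>" "pd 1 Wp = 1 - (Const \<omega>)\<^sup>2"
    "pd 0 Zp = (Const \<omega>)\<^sup>2 - 1" "pd 1 Zp = Const \<omega> - 1"
    unfolding Wp_def Zp_def power by (simp_all add: pd_add pd_diff pd_mult pd_X)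
  have pd_power: "pd i ((Const \<omega>)\<^sup>2) = 0" for i :: 2 unfolding power by simp
  have div: "(\<rho> (pd 0 (a 0)) - \<rho> (pd 2 (a 0))) + \<rho> (pd 3 (a 3)) =
      2 * c1 + (S * pd 0 c1 + T * pd 1 c1) + (T\<^sup>2 * pd 0 c2 + S\<^sup>2 * pd 1 c2)"
    by (rule divergence_identity[OF Const_\<omega> three_neq_0(2) Wp_def Zp_def, where ?Z0.0 = "\<rho> (pd 3 (a 0))"
          and ?P3.0 = "\<rho> (pd 0 (a 3)) - \<rho> (pd 2 (a 3))"];
        unfold restricted_chain_rule[symmetric] a0 a3)
      (simp_all add: pd_mult pd_diff pd_add pdW pd_X pd_power)
  have "(\<Sum>i\<in>UNIV. pd i twist * a i) = apply_vector_field a twist"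
    by (simp add: apply_vector_field_def mult.commute)
  also have "\<dots> = 3 * s\<^sup>2 * apply_vector_field a s - 3 * t\<^sup>2 * apply_vector_field a t"
    by (simp add: twist_def vf_diff vf_power3)
  finally have twist: "\<rho> (\<Sum>i\<in>UNIV. pd i twist * a i) = 3 * S\<^sup>2 * \<rho> (apply_vector_field a s) - 3 * T\<^sup>2 * \<rho> (apply_vector_field a t)"
    by simp
  have st: "\<rho> (apply_vector_field a s) = c1 * S + c2 * T\<^sup>2" "\<rho> (apply_vector_field a t) = c1 * T + c2 * S\<^sup>2"
    unfolding tangential_components_identity[OF Const_\<omega> Const_third Wp_def Zp_def, symmetric]
    by (simp_all add: s_def t_def vf_simps vf_power2 a1 a2 a0 a3)
  have "\<rho> (\<Sum>i\<in>UNIV. pd i twist * a i - pd i (a i)) =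
      \<rho> (\<Sum>i\<in>UNIV. pd i twist * a i) - (\<rho> (pd 0 (a 0)) + \<rho> (pd 1 (a 1)) + \<rho> (pd 2 (a 2)) + \<rho> (pd 3 (a 3)))"
    by (simp add: sum_subtractf) (simp add: sum_4')
  also have "\<rho> (pd 0 (a 0)) + \<rho> (pd 1 (a 1)) + \<rho> (pd 2 (a 2)) + \<rho> (pd 3 (a 3)) =
      ((\<rho> (pd 0 (a 0)) - \<rho> (pd 2 (a 0))) + \<rho> (pd 3 (a 3))) - 4 * c1"
    unfolding p1 p2 by simp
  also have "\<rho> (\<Sum>i\<in>UNIV. pd i twist * a i) - \<dots> =
      (2 * c1 - (S * pd 0 c1 + T * pd 1 c1) + 3 * (S ^ 3 - T ^ 3) * c1) - (T\<^sup>2 * pd 0 c2 + S\<^sup>2 * pd 1 c2)"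
    unfolding twist st div by (simp add: algebra_simps power2_eq_square power3_eq_cube)
  finally show ?thesis
    by (simp only: integral2_diff integral2_homogeneity integral2_rotation coef) simp
qed


section \<open>The arrangement\<close>

text \<open>
  The forms of \<open>(i, 2)\<close> change their sign here, three in number, because the product of all \<open>u\<^sub>i - v\<^sub>j\<close> is \<open>- f\<close>.
\<close>

definition normal :: "nat \<times> nat \<Rightarrow> complex ^ 4" where
  "normal x = (\<chi> k. (if snd x = 2 then - 1 else 1) * form_coeff x k)"

definition plane :: "nat \<times> nat \<Rightarrow> (complex ^ 4) set" where
  "plane x = affine_hyperplane (normal x) 0"

lemma generic_point_in_plane:
  assumes "x \<in> cells" "y \<in> cells"
  shows "(\<chi> k. generic_point x k) \<in> plane y \<longleftrightarrow> x = y"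
proof -
  have "(\<Sum>k\<in>UNIV. normal y $ k * generic_point x k) =
      (if snd y = 2 then - 1 else 1) * (\<Sum>k\<in>UNIV. form_coeff y k * generic_point x k)"
    by (simp add: normal_def sum_distrib_left mult.assoc)
  then show ?thesis
    using generic_point[OF assms] by (simp add: plane_def affine_hyperplane_def)
qed

lemma inj_plane: "inj_on plane cells"
  by (rule inj_onI) (metis generic_point_in_plane)

lemma normal_nonzero:
  assumes "x \<in> cells" shows "normal x \<noteq> 0"
proof
  assume "normal x = 0"
  then have "plane x = UNIV" by (simp add: plane_def affine_hyperplane_def)
  moreover have "\<exists>y\<in>cells. y \<noteq> x"
    by (rule bexI[of _ "if x = (0, 0) then (0, 1) else (0, 0)"]) (auto simp: cells_def)
  ultimately show False using generic_point_in_plane assms by blast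
qed

lemma affine_form_normal: "affine_form (normal x) 0 = (if snd x = 2 then - form x else form x)"
  by (simp add: affine_form_def normal_def form_def linear_form_def Const_hom sum_negf)

lemma defining_polynomial_planes: "defining_polynomial (plane ` cells) bracelet"
  unfolding defining_polynomial_def
proof (intro exI conjI ballI)
  let ?a = "\<lambda>H. normal (inv_into cells plane H)"
  fix H assume "H \<in> plane ` cells"
  then show "?a H \<noteq> 0" "H = affine_hyperplane (?a H) ((\<lambda>_. 0) H)"
    using normal_nonzero inv_into_into[of H plane cells] f_inv_into_f[of H plane cells]
    by (simp_all flip: plane_def)
next
  let ?a = "\<lambda>H. normal (inv_into cells plane H)"
  have "(\<Prod>H\<in>plane ` cells. affine_form (?a H) ((\<lambda>_. 0) H)) =
      (\<Prod>x\<in>cells. affine_form (?a (plane x)) 0)"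
    by (simp add: prod.reindex[OF inj_plane])
  also have "\<dots> = (\<Prod>x\<in>cells. if snd x = 2 then - form x else form x)"
    by (intro prod.cong HOL.refl) (simp add: inv_into_f_f[OF inj_plane] affine_form_normal)
  also have "\<dots> = - (\<Prod>x\<in>cells. form x)"
    unfolding cells_eq by simp
  finally show "bracelet = (\<Prod>H\<in>plane ` cells. affine_form (?a H) ((\<lambda>_. 0) H))"
    by (simp add: prod_forms)
qed

lemma central_planes: "central_arrangement (plane ` cells)"
proof -
  have "finite (plane ` cells)" by (simp add: cells_def)
  moreover have "\<exists>a b. a \<noteq> 0 \<and> plane x = affine_hyperplane a b" if "x \<in> cells" for x
    using normal_nonzero[OF that] plane_def by blast
  moreover have "0 \<in> plane x" for x by (simp add: plane_def affine_hyperplane_def)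
  ultimately show ?thesis
    unfolding central_arrangement_def hyperplane_arrangement_def by blast
qed

lemma bracelet_nonzero: "bracelet \<noteq> 0"
proof -
  have "(\<Prod>x\<in>cells. form x) \<noteq> 0"
    using prime_form by (auto simp: cells_def prod_zero_iff prime_elem_def)
  then show ?thesis by (simp add: prod_forms)
qed

lemma not_generated: "\<not> ann_fs_generated_by_derivations bracelet"
proof (rule not_generated_by_derivations)
  show "integral2 (\<rho> (a + b)) = integral2 (\<rho> a) + integral2 (\<rho> b)" for a b
    by (simp add: integral2_add)
  show "integral2 (\<rho> 0) = 0" by simp
  show "integral2 (\<rho> (\<Sum>i\<in>UNIV. pd i twist * a i - pd i (a i))) = 0"
    if "apply_vector_field a bracelet = 0" for a
    using that by (rule integral_of_divergence)
  show "pfaffian_op \<in> ann_fs bracelet" by (rule pfaffian_op_in_ann_fs[OF bracelet_nonzero])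
  show "integral2 (\<rho> (weyl_transpose twist pfaffian_op 1)) \<noteq> 0"
    unfolding \<rho>_transpose_pfaffian_op integral2_witness by simp
qed

theorem mainTheorem11:
  fixes f :: "4 mpoly"
  assumes "f = X 1 * X 2 * X 3 * (X 1 + X 0) * (X 2 + X 0) * (X 3 + X 0) *
               (X 1 + X 2 + X 0) * (X 1 + X 3 + X 0) * (X 2 + X 3 + X 0)"
  shows "\<exists>A :: (complex ^ 4) set set.
           central_arrangement A \<and> defining_polynomial A f \<and>
           \<not> ann_fs_generated_by_derivations f"
  using central_planes defining_polynomial_planes not_generated
  unfolding assms bracelet_def by blast

end
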